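(* Let $T, c \in (0,\infty)$, $\kappa \in [1,\infty)$, $\delta \in (0,\tfrac{1}{\kappa})$, $(f_d)_{d \in \mathbb{N}} \in \mathfrak{S}_{\kappa,\delta}$, let $u_d \in C^1([0,T]\times\mathbb{R}^d,\mathbb{R})$, $d \in \mathbb{N}$, satisfy $(u_d(0,\cdot))_{d\in\mathbb{N}} \in \mathfrak{S}_{\kappa,0}$, and assume for all $d \in \mathbb{N}$, $t \in [0,T]$, $x,y \in \mathbb{R}^d$ that $f_d \in C^1(\mathbb{R}^d,\mathbb{R}^d)$, $\|f_d(0)\| \le c d^c$, $\|f_d(x)-f_d(y)\| + |u_d(0,x)-u_d(0,y)| \le c\|x-y\|$, and $$\tfrac{\partial u_d}{\partial t}(t,x) = \tfrac{\partial u_d}{\partial x}(t,x)\, f_d(x).$$ Then it holds for all $t \in [0,T]$ that $(u_d(t,\cdot))_{d\in\mathbb{N}} \in \mathfrak{S}_{\kappa,0}$.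
   Context: $\mathbb{N}=\{1,2,3,\ldots\}$ and $\|\cdot\|$ is the Euclidean norm on every $\mathbb{R}^d$. Artificial neural networks (ANNs): $\mathscr{N} = \bigcup_{L\in\mathbb{N}}\bigcup_{l_0,l_1,\ldots,l_L\in\mathbb{N}} \left(\times_{k=1}^L (\mathbb{R}^{l_k\times l_{k-1}}\times\mathbb{R}^{l_k})\right)$. For $\Phi=((W_1,B_1),\ldots,(W_L,B_L)) \in \times_{k=1}^L (\mathbb{R}^{l_k\times l_{k-1}}\times\mathbb{R}^{l_k})$ the number of parameters is $\mathcal{P}(\Phi)=\sum_{k=1}^L l_k(l_{k-1}+1)$ and the ReLU realization $\mathscr{R}(\Phi)\in C(\mathbb{R}^{l_0},\mathbb{R}^{l_L})$ is given by $(\mathscr{R}(\Phi))(x_0)=W_Lx_{L-1}+B_L$, where $x_k$ is obtained for $0<k<L$ by applying $v\mapsto\max\{v,0\}$ componentwise to $W_kx_{k-1}+B_k$. Simplified approximation spaces: for $\kappa,\delta\in[0,\infty)$, $\mathfrak{S}_{\kappa,\delta}$ is the set of all sequences $(h_d)_{d\in\mathbb{N}}\subseteq\bigcup_{k,l\in\mathbb{N}}C(\mathbb{R}^k,\mathbb{R}^l)$ for which there exists $K\in\mathbb{R}$ such that for all $d\in\mathbb{N}$, $\varepsilon\in(0,1]$ there exist $\Phi\in\mathscr{N}$ and $\mathbf{d}\in\mathbb{N}$ such that for all $x\in\mathbb{R}^d$: $\{h_d,\mathscr{R}(\Phi)\}\subseteq C(\mathbb{R}^d,\mathbb{R}^{\mathbf{d}})$,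 $\mathcal{P}(\Phi)\le K\varepsilon^{-K}d^K$, $\|h_d(x)-(\mathscr{R}(\Phi))(x)\|\le\varepsilon(1+\|x\|^\kappa)$, and $\delta\|(\mathscr{R}(\Phi))(x)\|\le K(\varepsilon^{-\delta}d^K+\|x\|)$. *)

theory Defs
  imports "HOL-Analysis.Analysis" "Jordan_Normal_Form.Matrix"
begin

(* Points of R^d, with d a natural number that may be quantified over, are elements of
   carrier_vec d. All functions on R^d are total functions on vectors of any dimension;
   only their values on carrier_vec d matter. *)
type_synonym rvec = "real Matrix.vec"
type_synonym rmat = "real Matrix.mat"

definition vnorm :: "rvec \<Rightarrow> real" where
  "vnorm x = L2_set (vec_index x) {..<dim_vec x}"

definition euclid_dist :: "nat \<Rightarrow> rvec \<Rightarrow> rvec \<Rightarrow> real" where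
  "euclid_dist d x y = L2_set (\<lambda>i. vec_index x i - vec_index y i) {..<d}"

lemma euclid_dist_eq_vnorm:
  assumes "x \<in> carrier_vec d" "y \<in> carrier_vec d"
  shows "euclid_dist d x y = vnorm (x - y)"
  using assms unfolding euclid_dist_def vnorm_def by (auto intro!: L2_set_cong)

lemma Metric_space_euclid_dist: "Metric_space (carrier_vec d) (euclid_dist d)"
proof
  fix x y :: rvec
  show "0 \<le> euclid_dist d x y" by (simp add: euclid_dist_def)
  show "euclid_dist d x y = euclid_dist d y x"
    by (simp add: euclid_dist_def L2_set_def power2_commute)
next
  fix x y :: rvec assume "x \<in> carrier_vec d" "y \<in> carrier_vec d"
  then show "(euclid_dist d x y = 0) = (x = y)"
    by (auto simp: euclid_dist_def L2_set_eq_0_iff)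
next
  fix x y z :: rvec
  show "euclid_dist d x z \<le> euclid_dist d x y + euclid_dist d y z"
    unfolding euclid_dist_def
    using L2_set_triangle_ineq[of "\<lambda>i. vec_index x i - vec_index y i"
        "\<lambda>i. vec_index y i - vec_index z i" "{..<d}"] by simp
qed

definition Rtop :: "nat \<Rightarrow> rvec topology" where
  "Rtop d = Metric_space.mtopology (carrier_vec d) (euclid_dist d)"

lemma topspace_Rtop: "topspace (Rtop d) = carrier_vec d"
  unfolding Rtop_def by (rule Metric_space.topspace_mtopology[OF Metric_space_euclid_dist])

(* C(R^k, R^l) *)
definition Cont :: "nat \<Rightarrow> nat \<Rightarrow> (rvec \<Rightarrow> rvec) set" where
  "Cont k l = {h. continuous_map (Rtop k) (Rtop l) h}"

definition emb1 :: "real \<Rightarrow> rvec" where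
  "emb1 r = Matrix.vec 1 (\<lambda>_. r)"


(* A network is the list of its layers (W, B), first layer first. *)
type_synonym ann = "(rmat \<times> rvec) list"

(* L is the number of layers and l 0, ..., l L are the layer dimensions. *)
definition ANN :: "ann set" where
  "ANN = (\<Union>L\<in>{1..}. \<Union>l\<in>{l. \<forall>k\<le>L. (1::nat) \<le> l k}.
     {\<Phi>. length \<Phi> = L \<and>
       (\<forall>k<L. fst (\<Phi> ! k) \<in> carrier_mat (l (Suc k)) (l k) \<and>
              snd (\<Phi> ! k) \<in> carrier_vec (l (Suc k)))})"

definition in_dim :: "ann \<Rightarrow> nat" where
  "in_dim \<Phi> = dim_col (fst (hd \<Phi>))"

definition num_params :: "ann \<Rightarrow> nat" where
  "num_params \<Phi> = (\<Sum>(W, B)\<leftarrow>\<Phi>. dim_row W * (dim_col W + 1))"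

(* The clause for the empty list is irrelevant, since [] is not in ANN. *)
fun realization :: "ann \<Rightarrow> rvec \<Rightarrow> rvec" where
  "realization [] x = x"
| "realization [(W, B)] x = W *\<^sub>v x + B"
| "realization ((W, B) # L # \<Phi>) x =
     realization (L # \<Phi>) (map_vec (\<lambda>v. max v 0) (W *\<^sub>v x + B))"


(* Sequences are indexed by d \<ge> 1; the value at d = 0 is irrelevant.
   The conjunct in_dim \<Phi> = d expresses that the domain of the realization is R^d, which
   membership of the total function realization \<Phi> in Cont d dd does not enforce.
   The case distinction gives the convention 0^0 = 1 (whereas 0 powr 0 = 0). *)
definition approx_space :: "real \<Rightarrow> real \<Rightarrow> (nat \<Rightarrow> rvec \<Rightarrow> rvec) set" where
  "approx_space \<kappa> \<delta> = {h.
     (\<forall>d\<ge>1. h d \<in> (\<Union>k\<in>{1..}. \<Union>l\<in>{1..}. Cont k l)) \<and>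
     (\<exists>K::real. \<forall>d\<ge>1. \<forall>\<epsilon>\<in>{0<..1}. \<exists>\<Phi>\<in>ANN. \<exists>dd\<ge>1. \<forall>x\<in>carrier_vec d.
        in_dim \<Phi> = d \<and> {h d, realization \<Phi>} \<subseteq> Cont d dd \<and>
        real (num_params \<Phi>) \<le> K * \<epsilon> powr (- K) * real d powr K \<and>
        vnorm (h d x - realization \<Phi> x)
          \<le> \<epsilon> * (1 + (if \<kappa> = 0 then 1 else vnorm x powr \<kappa>)) \<and>
        \<delta> * vnorm (realization \<Phi> x)
          \<le> K * (\<epsilon> powr (- \<delta>) * real d powr K + vnorm x))}"


(* For g defined on R^d: restriction of g to the line through x in the i-th coordinate direction. *)
definition coord_line :: "nat \<Rightarrow> nat \<Rightarrow> (rvec \<Rightarrow> real) \<Rightarrow> rvec \<Rightarrow> real \<Rightarrow> real" where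
  "coord_line d i g x s = g (x + s \<cdot>\<^sub>v unit_vec d i)"

definition partial_x :: "nat \<Rightarrow> nat \<Rightarrow> (rvec \<Rightarrow> real) \<Rightarrow> rvec \<Rightarrow> real" where
  "partial_x d i g x = deriv (coord_line d i g x) 0"

definition grad_x :: "nat \<Rightarrow> (rvec \<Rightarrow> real) \<Rightarrow> rvec \<Rightarrow> rvec" where
  "grad_x d g x = Matrix.vec d (\<lambda>i. partial_x d i g x)"

(* One-sided derivative at the end points of [0,T]. *)
definition partial_t :: "real \<Rightarrow> (real \<Rightarrow> rvec \<Rightarrow> real) \<Rightarrow> real \<Rightarrow> rvec \<Rightarrow> real" where
  "partial_t T w t x = vector_derivative (\<lambda>s. w s x) (at t within {0..T})"

(* C^1(R^d, R^m): all first-order partial derivatives exist and are continuous. *)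
definition C1 :: "nat \<Rightarrow> nat \<Rightarrow> (rvec \<Rightarrow> rvec) set" where
  "C1 d m = {g \<in> Cont d m. \<forall>j<m. \<forall>i<d.
     (\<forall>x\<in>carrier_vec d. coord_line d i (\<lambda>y. vec_index (g y) j) x differentiable (at 0)) \<and>
     continuous_map (Rtop d) euclideanreal (partial_x d i (\<lambda>y. vec_index (g y) j))}"

(* C^1([0,T] x R^d, R), with derivatives in t relative to [0,T]. *)
definition C1_cyl :: "real \<Rightarrow> nat \<Rightarrow> (real \<Rightarrow> rvec \<Rightarrow> real) set" where
  "C1_cyl T d = {w.
     continuous_map (prod_topology (top_of_set {0..T}) (Rtop d)) euclideanreal
       (\<lambda>(t, x). w t x) \<and>
     (\<forall>t\<in>{0..T}. \<forall>x\<in>carrier_vec d.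
        (\<lambda>s. w s x) differentiable (at t within {0..T}) \<and>
        (\<forall>i<d. coord_line d i (w t) x differentiable (at 0))) \<and>
     continuous_map (prod_topology (top_of_set {0..T}) (Rtop d)) euclideanreal
       (\<lambda>(t, x). partial_t T w t x) \<and>
     (\<forall>i<d. continuous_map (prod_topology (top_of_set {0..T}) (Rtop d)) euclideanreal
       (\<lambda>(t, x). partial_x d i (w t) x))}"

end

theory Submission
  imports Defs
begin

text \<open>
  The solution is \<open>u(t, x) = u(0, X\<^sub>t(x))\<close> with \<open>X\<close> the flow of \<open>f\<close>. The flow itself is never needed:
  by the transport equation and uniform continuity of the first derivatives on compact sets, one
  Euler step of length \<open>h\<close> along \<open>f\<close> changes \<open>u\<close> by \<open>o(h)\<close>, so \<open>u(t, x)\<close> is the limit of \<open>u(0, \<cdot>)\<close>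
  evaluated at Euler polygons. This makes \<open>u(t, \<cdot>)\<close> Lipschitz with the dimension-free constant
  \<open>c exp(c T)\<close>, and telescoping along the Euler scheme of a network \<open>\<phi>\<close> that approximates \<open>f\<close> to accuracy
  \<open>\<eta>\<close> gives an error of order \<open>1/N\<close> times \<open>\<eta>\<^sup>-\<^sup>\<delta>\<close> plus \<open>\<eta>\<close> times \<open>\<eta>\<^sup>-\<^sup>\<delta>\<^sup>\<kappa>\<close>, up to powers of \<open>d\<close>. Since
  \<open>\<delta> \<kappa> < 1\<close>, both terms are small for \<open>\<eta>\<close> and \<open>1/N\<close> polynomially small. The \<open>N\<close>-step scheme followed by
  a network for \<open>u(0, \<cdot>)\<close> is again a network, of size linear in \<open>N\<close>, because \<open>y\<close> is passed from step to
  step as the pair of its positive and negative parts.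
\<close>

unbundle no vec_syntax

section \<open>The Euclidean norm and the topology of \<open>\<real>\<^sup>d\<close>\<close>

lemma vnorm_nonneg [simp]: "0 \<le> vnorm x"
  by (simp add: vnorm_def)

lemma vnorm_triangle:
  assumes "x \<in> carrier_vec d" "y \<in> carrier_vec d"
  shows "vnorm (x + y) \<le> vnorm x + vnorm y"
proof -
  have "vnorm (x + y) = L2_set (\<lambda>i. x $ i + y $ i) {..<d}"
    using assms unfolding vnorm_def by (auto intro!: L2_set_cong)
  also have "\<dots> \<le> vnorm x + vnorm y"
    using assms L2_set_triangle_ineq[of "vec_index x" "vec_index y" "{..<d}"]
    by (simp add: vnorm_def)
  finally show ?thesis .
qed

lemma vnorm_smult: "vnorm (a \<cdot>\<^sub>v x) = \<bar>a\<bar> * vnorm x"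
proof -
  have "vnorm (a \<cdot>\<^sub>v x) = sqrt (\<Sum>i<dim_vec x. a\<^sup>2 * (x $ i)\<^sup>2)"
    by (simp add: vnorm_def L2_set_def power_mult_distrib)
  also have "\<dots> = \<bar>a\<bar> * vnorm x"
    by (simp add: vnorm_def L2_set_def real_sqrt_mult flip: sum_distrib_left)
  finally show ?thesis .
qed

lemma vnorm_mono:
  assumes "x \<in> carrier_vec d" "y \<in> carrier_vec d" "\<And>i. i < d \<Longrightarrow> \<bar>x $ i\<bar> \<le> \<bar>y $ i\<bar>"
  shows "vnorm x \<le> vnorm y"
proof -
  have "vnorm x = L2_set (\<lambda>i. \<bar>x $ i\<bar>) {..<d}" "vnorm y = L2_set (\<lambda>i. \<bar>y $ i\<bar>) {..<d}"
    using assms(1,2) by (auto simp: vnorm_def L2_set_def)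
  moreover have "L2_set (\<lambda>i. \<bar>x $ i\<bar>) {..<d} \<le> L2_set (\<lambda>i. \<bar>y $ i\<bar>) {..<d}"
    by (rule L2_set_mono) (auto intro!: assms(3))
  ultimately show ?thesis by simp
qed

lemma vnorm_le_diff:
  assumes "x \<in> carrier_vec d" "y \<in> carrier_vec d"
  shows "vnorm x \<le> vnorm y + vnorm (x - y)"
proof -
  have "x = y + (x - y)" using assms by (intro eq_vecI) auto
  then show ?thesis using vnorm_triangle[of y d "x - y"] assms by simp
qed

lemma index_le_vnorm: "i < dim_vec x \<Longrightarrow> \<bar>x $ i\<bar> \<le> vnorm x"
  using member_le_L2_set[of "{..<dim_vec x}" i "\<lambda>i. \<bar>x $ i\<bar>"]
  by (simp add: vnorm_def L2_set_def)

text \<open>The Euclidean distance is at most the sum of the coordinate distances, so a small open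
  box lands in a ball. Through this map, compactness and componentwise continuity pass from the
  product topology to \<open>Rtop\<close>.\<close>

lemma continuous_map_vec:
  "continuous_map (product_topology (\<lambda>_. euclideanreal) {..<d}) (Rtop d) (Matrix.vec d)"
  unfolding Rtop_def Metric_space.continuous_map_to_metric[OF Metric_space_euclid_dist]
proof (intro ballI allI impI)
  fix x :: "nat \<Rightarrow> real" and e :: real
  assume x: "x \<in> topspace (product_topology (\<lambda>_. euclideanreal) {..<d})" and e: "0 < e"
  \<comment> \<open>The \<open>+ 1\<close> makes \<open>d * r\<close> strictly smaller than
    \<open>e\<close> and covers \<open>d = 0\<close>.\<close>
  define r where "r = e / (real d + 1)"
  have r: "0 < r" using e by (simp add: r_def)
  define U where "U = PiE {..<d} (\<lambda>i. {x i - r<..<x i + r})"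
  have "openin (product_topology (\<lambda>_. euclideanreal) {..<d}) U"
    unfolding U_def by (subst openin_PiE) simp_all
  moreover have "x \<in> U" using x r by (simp add: U_def topspace_product_topology PiE_iff)
  moreover have "Matrix.vec d y \<in> Metric_space.mball (carrier_vec d) (euclid_dist d) (Matrix.vec d x) e"
    if y: "y \<in> U" for y
  proof -
    have "euclid_dist d (Matrix.vec d x) (Matrix.vec d y) \<le> (\<Sum>i<d. \<bar>x i - y i\<bar>)"
      unfolding euclid_dist_def using L2_set_le_sum_abs[of "\<lambda>i. x i - y i" "{..<d}"]
      by (simp add: L2_set_def)
    also have "\<dots> \<le> (\<Sum>i<d. r)"
    proof (rule sum_mono)
      fix i assume "i \<in> {..<d}"
      with y have "y i \<in> {x i - r<..<x i + r}" unfolding U_def by (rule PiE_mem)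
      then show "\<bar>x i - y i\<bar> \<le> r" by (simp add: abs_le_iff)
    qed
    also have "\<dots> < e" using e by (simp add: r_def field_simps)
    finally show ?thesis by (simp add: Metric_space.in_mball[OF Metric_space_euclid_dist])
  qed
  ultimately show "\<exists>U. openin (product_topology (\<lambda>_. euclideanreal) {..<d}) U \<and> x \<in> U \<and>
     (\<forall>y\<in>U. Matrix.vec d y \<in> Metric_space.mball (carrier_vec d) (euclid_dist d) (Matrix.vec d x) e)"
    by blast
qed

lemma compactin_box:
  "compactin (Rtop d) {x \<in> carrier_vec d. \<forall>i<d. \<bar>x $ i\<bar> \<le> R}"
proof -
  have "compactin (product_topology (\<lambda>_. euclideanreal) {..<d}) (PiE {..<d} (\<lambda>_. {-R..R}))"
    by (simp add: compactin_PiE)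
  from image_compactin[OF this continuous_map_vec]
  have "compactin (Rtop d) (Matrix.vec d ` PiE {..<d} (\<lambda>_. {-R..R}))" .
  moreover have "Matrix.vec d ` PiE {..<d} (\<lambda>_. {-R..R}) = {x \<in> carrier_vec d. \<forall>i<d. \<bar>x $ i\<bar> \<le> R}"
  proof (intro equalityI subsetI)
    fix x assume "x \<in> {x \<in> carrier_vec d. \<forall>i<d. \<bar>x $ i\<bar> \<le> R}"
    then have x: "dim_vec x = d" "\<And>i. i < d \<Longrightarrow> \<bar>x $ i\<bar> \<le> R" by simp_all
    have "x = Matrix.vec d (restrict (vec_index x) {..<d})"
      using x(1) by (intro eq_vecI) simp_all
    moreover have "restrict (vec_index x) {..<d} \<in> PiE {..<d} (\<lambda>_. {-R..R})"
      using x(2) by (simp add: PiE_iff abs_le_iff minus_le_iff)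
    ultimately show "x \<in> Matrix.vec d ` PiE {..<d} (\<lambda>_. {-R..R})" by (rule image_eqI)
  next
    fix x assume "x \<in> Matrix.vec d ` PiE {..<d} (\<lambda>_. {-R..R})"
    then obtain g where g: "x = Matrix.vec d g" "g \<in> PiE {..<d} (\<lambda>_. {-R..R})" by (rule imageE)
    have "\<bar>g i\<bar> \<le> R" if "i < d" for i
      using PiE_mem[OF g(2), of i] that by (simp add: abs_le_iff minus_le_iff)
    then show "x \<in> {x \<in> carrier_vec d. \<forall>i<d. \<bar>x $ i\<bar> \<le> R}" by (simp add: g(1))
  qed
  ultimately show ?thesis by simp
qed

section \<open>Uniform continuity and first-order expansion on the space-time cylinder\<close>

text \<open>Heine-Cantor on the compact product of \<open>{0..T}\<close> with the cube of half side
  \<open>R\<close>, which contains the Euclidean ball of radius \<open>R\<close>.\<close>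

lemma uniformly_continuous_cylinder:
  assumes "continuous_map (prod_topology (top_of_set {0..T}) (Rtop d)) euclideanreal (\<lambda>(t, x). w t x)"
    and e: "0 < e"
  shows "\<exists>\<delta>>0. \<forall>s\<in>{0..T}. \<forall>s'\<in>{0..T}. \<forall>x\<in>carrier_vec d. \<forall>x'\<in>carrier_vec d.
    vnorm x \<le> R \<longrightarrow> vnorm x' \<le> R \<longrightarrow> \<bar>s - s'\<bar> < \<delta> \<longrightarrow> vnorm (x - x') < \<delta> \<longrightarrow> \<bar>w s x - w s' x'\<bar> < e"
proof -
  interpret Metric_space "carrier_vec d" "euclid_dist d" by (rule Metric_space_euclid_dist)
  define K where "K = {x \<in> carrier_vec d. \<forall>i<d. \<bar>x $ i\<bar> \<le> R}"
  define m2 where "m2 = submetric (metric (carrier_vec d, euclid_dist d)) K"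
  define m1 where "m1 = submetric euclidean_metric {0..T::real}"
  define m where "m = prod_metric m1 m2"
  have K: "K \<subseteq> carrier_vec d" by (auto simp: K_def)
  have t1: "mtopology_of m1 = top_of_set {0..T}"
    by (simp add: m1_def mtopology_of_submetric)
  have t2: "mtopology_of m2 = subtopology (Rtop d) K"
    by (simp add: m2_def mtopology_of_submetric mtopology_of Rtop_def)
  have tm: "mtopology_of m = prod_topology (top_of_set {0..T}) (subtopology (Rtop d) K)"
    by (simp add: m_def mtopology_of_prod_metric t1 t2)
  have sp: "mspace m = {0..T} \<times> K"
    using K by (auto simp: m_def m1_def m2_def)
  have "compact_space (mtopology_of m)"
    unfolding tm compact_space_prod_topology using compactin_box[of d R] K
    by (auto simp: compact_space_subtopology K_def)
  moreover have "continuous_map (mtopology_of m) (mtopology_of euclidean_metric) (\<lambda>(t, x). w t x)"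
  proof -
    have "prod_topology (top_of_set {0..T}) (subtopology (Rtop d) K) =
      subtopology (prod_topology (top_of_set {0..T}) (Rtop d)) (UNIV \<times> K)"
      by (simp add: subtopology_Times)
    then show ?thesis using assms(1) unfolding tm
      by (simp add: continuous_map_from_subtopology)
  qed
  ultimately have "uniformly_continuous_map m euclidean_metric (\<lambda>(t, x). w t x)"
    by (intro continuous_imp_uniformly_continuous_map) simp
  then obtain \<delta> where \<delta>: "0 < \<delta>" "\<forall>p\<in>mspace m. \<forall>q\<in>mspace m. mdist m q p < \<delta> \<longrightarrow>
     mdist euclidean_metric ((\<lambda>(t, x). w t x) q) ((\<lambda>(t, x). w t x) p) < e"
    using e unfolding uniformly_continuous_map_def by meson
  \<comment> \<open>The product distance is at most the sum of the time and space distances, hence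
    \<open>\<delta> / 2\<close> for each.\<close>
  have "\<bar>w s x - w s' x'\<bar> < e"
    if "s\<in>{0..T}" "s'\<in>{0..T}" "x\<in>carrier_vec d" "x'\<in>carrier_vec d" "vnorm x \<le> R" "vnorm x' \<le> R"
      "\<bar>s - s'\<bar> < \<delta> / 2" "vnorm (x - x') < \<delta> / 2" for s s' x x'
  proof -
    have "x \<in> K" "x' \<in> K"
      using that index_le_vnorm[of _ x] index_le_vnorm[of _ x'] by (force simp: K_def)+
    moreover have "mdist m (s, x) (s', x') < \<delta>"
    proof -
      have "mdist m (s, x) (s', x') = sqrt ((dist s s')\<^sup>2 + (vnorm (x - x'))\<^sup>2)"
        using that by (simp add: m_def m1_def m2_def prod_dist_def euclid_dist_eq_vnorm)
      also have "\<dots> \<le> dist s s' + vnorm (x - x')"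
        by (rule sqrt_sum_squares_le_sum) auto
      finally show ?thesis using that by (simp add: dist_real_def)
    qed
    ultimately show ?thesis
      using \<delta>(2) that(1,2) unfolding sp by (fastforce simp: dist_real_def)
  qed
  then show ?thesis using \<delta>(1) by (intro exI[of _ "\<delta> / 2"]) auto
qed

text \<open>Since the data are partial derivatives, the mean value theorem is applied along an
  axis-parallel path: from \<open>v\<close> to \<open>v + r z\<close> one coordinate at a time at
  time \<open>s\<close>, then back in time from \<open>s\<close> to \<open>s - r\<close>. On each
  piece the derivative differs from its value at \<open>(s, v)\<close> by at most
  \<open>e\<close>.\<close>

lemma C1_cyl_increment:
  assumes w: "w \<in> C1_cyl T d"
    and vz: "v \<in> carrier_vec d" "z \<in> carrier_vec d"
    and r: "0 \<le> r" "0 \<le> s - r" "s \<le> T"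
    and small: "r < \<delta>" "r * vnorm z < \<delta>" "vnorm v + r * vnorm z \<le> R"
    and unift: "\<And>s' x. s' \<in> {0..T} \<Longrightarrow> x \<in> carrier_vec d \<Longrightarrow> vnorm x \<le> R \<Longrightarrow> \<bar>s' - s\<bar> < \<delta> \<Longrightarrow>
       vnorm (x - v) < \<delta> \<Longrightarrow> \<bar>partial_t T w s' x - partial_t T w s v\<bar> \<le> e"
    and unifx: "\<And>x i. x \<in> carrier_vec d \<Longrightarrow> vnorm x \<le> R \<Longrightarrow> i < d \<Longrightarrow>
       vnorm (x - v) < \<delta> \<Longrightarrow> \<bar>partial_x d i (w s) x - partial_x d i (w s) v\<bar> \<le> e"
  shows "\<bar>w (s - r) (v + r \<cdot>\<^sub>v z) - w s v -
     r * ((\<Sum>i<d. partial_x d i (w s) v * z $ i) - partial_t T w s v)\<bar> \<le> r * e * (1 + (\<Sum>i<d. \<bar>z $ i\<bar>))"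
proof -
  have s: "s \<in> {0..T}" using r by simp
  \<comment> \<open>Every spatial point of the path satisfies this coordinatewise bound, so the
    oscillation bounds \<open>unift\<close> and \<open>unifx\<close> apply there.\<close>
  have near: "x \<in> carrier_vec d \<and> vnorm x \<le> R \<and> vnorm (x - v) < \<delta>"
    if x: "x \<in> carrier_vec d" and xi: "\<And>i. i < d \<Longrightarrow> \<bar>x $ i - v $ i\<bar> \<le> r * \<bar>z $ i\<bar>" for x
  proof -
    have "vnorm (x - v) \<le> vnorm (r \<cdot>\<^sub>v z)"
      using x vz xi r by (intro vnorm_mono[of _ d]) (auto simp: abs_mult)
    then have "vnorm (x - v) \<le> r * vnorm z" using r by (simp add: vnorm_smult)
    with vnorm_le_diff[OF x vz(1)] small x show ?thesis by linarith
  qed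
  define y where "y = v + r \<cdot>\<^sub>v z"
  have y: "y \<in> carrier_vec d" using vz by (simp add: y_def)
  have time: "\<bar>w (s - r) y - w s y + r * partial_t T w s v\<bar> \<le> r * e"
  proof (cases "r = 0")
    case False
    then have r0: "0 < r" using r by simp
    have "\<exists>\<tau>\<in>{s - r<..<s}. w s y - w (s - r) y = (\<lambda>h. h *\<^sub>R partial_t T w \<tau> y) (s - (s - r))"
    proof (rule mvt_simple[of "s - r" s "\<lambda>\<tau>. w \<tau> y"])
      fix \<tau> assume \<tau>: "s - r \<le> \<tau>" "\<tau> \<le> s"
      then have "(\<lambda>\<tau>. w \<tau> y) differentiable (at \<tau> within {0..T})"
        using w y r unfolding C1_cyl_def by simp
      then have "((\<lambda>\<tau>. w \<tau> y) has_vector_derivative partial_t T w \<tau> y) (at \<tau> within {0..T})"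
        unfolding partial_t_def by (simp add: vector_derivative_works)
      then show "((\<lambda>\<tau>. w \<tau> y) has_derivative (\<lambda>h. h *\<^sub>R partial_t T w \<tau> y)) (at \<tau> within {s - r..s})"
        unfolding has_vector_derivative_def using r
        by (elim has_derivative_subset) auto
    qed (use r0 in simp)
    then obtain \<tau> where \<tau>: "s - r < \<tau>" "\<tau> < s" "w s y - w (s - r) y = r * partial_t T w \<tau> y"
      by auto
    have "\<bar>y $ i - v $ i\<bar> \<le> r * \<bar>z $ i\<bar>" if "i < d" for i
      using vz r that by (simp add: y_def abs_mult)
    with near[OF y] have "\<bar>partial_t T w \<tau> y - partial_t T w s v\<bar> \<le> e"
      using \<tau> r small by (intro unift) auto
    then have "r * \<bar>partial_t T w \<tau> y - partial_t T w s v\<bar> \<le> r * e"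
      using r by (simp add: mult_left_mono)
    moreover have "w (s - r) y - w s y + r * partial_t T w s v = r * (partial_t T w s v - partial_t T w \<tau> y)"
      using \<tau>(3) by (simp add: algebra_simps)
    ultimately show ?thesis using r by (simp add: abs_mult abs_minus_commute)
  qed simp
  \<comment> \<open>\<open>p k\<close> has its first \<open>k\<close> coordinates already moved; the
    path runs from \<open>p 0 = v\<close> to \<open>p d = y\<close>.\<close>
  define p where "p k = Matrix.vec d (\<lambda>i. if i < k then v $ i + r * z $ i else v $ i)" for k
  have p: "p k \<in> carrier_vec d" for k by (simp add: p_def)
  have space: "\<bar>w s (p (Suc k)) - w s (p k) - r * (partial_x d k (w s) v * z $ k)\<bar> \<le> r * e * \<bar>z $ k\<bar>"
    if k: "k < d" for k
  proof -
    define a where "a = r * z $ k"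
    define q where "q \<theta> = p k + (\<theta> * a) \<cdot>\<^sub>v unit_vec d k" for \<theta>
    have q: "q \<theta> \<in> carrier_vec d" for \<theta> by (simp add: q_def p)
    \<comment> \<open>\<open>partial_x\<close> is a derivative at parameter \<open>0\<close> only;
      rebasing the coordinate line at \<open>q \<theta>\<close> turns it into a derivative at an
      arbitrary parameter.\<close>
    have deriv: "((\<lambda>\<theta>. w s (q \<theta>)) has_real_derivative a * partial_x d k (w s) (q \<theta>)) (at \<theta>)" for \<theta>
    proof -
      have "coord_line d k (w s) (q \<theta>) differentiable (at 0)"
        using w s q k unfolding C1_cyl_def by simp
      then have "(coord_line d k (w s) (q \<theta>) has_real_derivative partial_x d k (w s) (q \<theta>)) (at 0)"
        unfolding partial_x_def using DERIV_deriv_iff_real_differentiable by blast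
      moreover have "((\<lambda>\<xi>. (\<xi> - \<theta>) * a) has_real_derivative a) (at \<theta>)"
        by (auto intro!: derivative_eq_intros)
      ultimately have "((\<lambda>\<xi>. coord_line d k (w s) (q \<theta>) ((\<xi> - \<theta>) * a)) has_real_derivative
          partial_x d k (w s) (q \<theta>) * a) (at \<theta>)"
        using DERIV_chain2[of "coord_line d k (w s) (q \<theta>)" _ "\<lambda>\<xi>. (\<xi> - \<theta>) * a" \<theta> a UNIV] by simp
      moreover have "coord_line d k (w s) (q \<theta>) ((\<xi> - \<theta>) * a) = w s (q \<xi>)" for \<xi>
      proof -
        have "q \<theta> + ((\<xi> - \<theta>) * a) \<cdot>\<^sub>v unit_vec d k = q \<xi>"
          unfolding q_def using p[of k] by (intro eq_vecI) (auto simp: algebra_simps)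
        then show ?thesis by (simp add: coord_line_def)
      qed
      ultimately show ?thesis by (simp add: mult.commute)
    qed
    obtain \<theta> where \<theta>: "0 < \<theta>" "\<theta> < 1" "w s (q 1) - w s (q 0) = a * partial_x d k (w s) (q \<theta>)"
      using MVT2[of 0 1 "\<lambda>\<theta>. w s (q \<theta>)" "\<lambda>\<theta>. a * partial_x d k (w s) (q \<theta>)"] deriv by auto
    have q0: "q 0 = p k" unfolding q_def using p[of k] by (intro eq_vecI) auto
    have q1: "q 1 = p (Suc k)"
      unfolding q_def p_def a_def using k by (intro eq_vecI) (auto simp: less_Suc_eq)
    have "\<bar>q \<theta> $ i - v $ i\<bar> \<le> r * \<bar>z $ i\<bar>" if "i < d" for i
    proof -
      have "\<theta> * (r * \<bar>z $ k\<bar>) \<le> 1 * (r * \<bar>z $ k\<bar>)"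
        using \<theta> r by (intro mult_right_mono) auto
      then show ?thesis using that k r(1) \<theta>(1) by (auto simp: q_def p_def a_def abs_mult)
    qed
    with near[OF q] have "\<bar>partial_x d k (w s) (q \<theta>) - partial_x d k (w s) v\<bar> \<le> e"
      using k by (intro unifx) auto
    then have "\<bar>a\<bar> * \<bar>partial_x d k (w s) (q \<theta>) - partial_x d k (w s) v\<bar> \<le> \<bar>a\<bar> * e"
      by (simp add: mult_left_mono)
    moreover have "w s (p (Suc k)) - w s (p k) - r * (partial_x d k (w s) v * z $ k) =
       a * (partial_x d k (w s) (q \<theta>) - partial_x d k (w s) v)"
      using \<theta>(3) by (simp add: q0 q1 a_def algebra_simps)
    ultimately show ?thesis using r by (simp add: abs_mult a_def mult_ac)
  qed
  have p0: "p 0 = v" and pd: "p d = y" using vz by (auto simp: p_def y_def)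
  have "w s y - w s v = (\<Sum>k<d. w s (p (Suc k)) - w s (p k))"
    by (simp only: sum_lessThan_telescope[of "\<lambda>k. w s (p k)"] p0 pd)
  then have "w s y - w s v - r * (\<Sum>k<d. partial_x d k (w s) v * z $ k) =
     (\<Sum>k<d. w s (p (Suc k)) - w s (p k) - r * (partial_x d k (w s) v * z $ k))"
    by (simp only: sum_distrib_left flip: sum_subtractf)
  also have "\<bar>\<dots>\<bar> \<le> (\<Sum>k<d. r * e * \<bar>z $ k\<bar>)"
    using space by (intro order_trans[OF sum_abs] sum_mono) auto
  finally have "\<bar>w s y - w s v - r * (\<Sum>k<d. partial_x d k (w s) v * z $ k)\<bar> \<le> r * e * (\<Sum>k<d. \<bar>z $ k\<bar>)"
    by (simp add: sum_distrib_left)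
  with time show ?thesis
    unfolding y_def[symmetric] by (simp add: algebra_simps)
qed

section \<open>ReLU networks as functions\<close>

definition relu :: "rvec \<Rightarrow> rvec" where
  "relu x = map_vec (\<lambda>v. max v 0) x"

lemma relu_carrier [simp]: "relu x \<in> carrier_vec n \<longleftrightarrow> x \<in> carrier_vec n"
  by (simp add: relu_def)

lemma relu_append: "relu (x @\<^sub>v y) = relu x @\<^sub>v relu y"
  unfolding relu_def by (intro eq_vecI) auto

lemma relu_nonneg: "\<forall>i<dim_vec x. 0 \<le> x $ i \<Longrightarrow> relu x = x"
  unfolding relu_def by (intro eq_vecI) auto

text \<open>The positive part followed by the negative part: both are nonnegative, hence fixed by
  any further \<open>relu\<close>, and their difference is \<open>x\<close>.\<close>

definition split_vec :: "rvec \<Rightarrow> rvec" where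
  "split_vec x = relu (x @\<^sub>v - x)"

lemma split_vec_carrier [simp]: "x \<in> carrier_vec n \<Longrightarrow> split_vec x \<in> carrier_vec (n + n)"
  by (simp add: split_vec_def)

lemma split_vec_nonneg: "i < dim_vec (split_vec x) \<Longrightarrow> 0 \<le> split_vec x $ i"
  by (auto simp: split_vec_def relu_def)

lemma append_cols_obtain:
  fixes A C :: rmat
  assumes "A \<in> carrier_mat l k" "C \<in> carrier_mat l n"
  obtains M where "M \<in> carrier_mat l (k + n)"
    "\<And>x z. x \<in> carrier_vec k \<Longrightarrow> z \<in> carrier_vec n \<Longrightarrow> M *\<^sub>v (x @\<^sub>v z) = A *\<^sub>v x + C *\<^sub>v z"
proof
  define M where "M = mat l (k + n) (\<lambda>(i,j). if j < k then A $$ (i,j) else C $$ (i,j-k))"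
  show "M \<in> carrier_mat l (k + n)" by (simp add: M_def)
  fix x z :: rvec assume x: "x \<in> carrier_vec k" and z: "z \<in> carrier_vec n"
  show "M *\<^sub>v (x @\<^sub>v z) = A *\<^sub>v x + C *\<^sub>v z"
  proof (rule eq_vecI)
    fix i assume "i < dim_vec (A *\<^sub>v x + C *\<^sub>v z)"
    then have i: "i < l" using assms by simp
    have "row M i = row A i @\<^sub>v row C i"
      using assms i by (intro eq_vecI) (auto simp: M_def)
    then show "(M *\<^sub>v (x @\<^sub>v z)) $ i = (A *\<^sub>v x + C *\<^sub>v z) $ i"
      using assms i x z
      by (simp add: M_def scalar_prod_append[of _ k _ n])
  qed (use assms in \<open>simp add: M_def\<close>)
qed

lemma mult_mat_vec_uminus:
  assumes "(A :: rmat) \<in> carrier_mat l k" "x \<in> carrier_vec k"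
  shows "(- A) *\<^sub>v x = - (A *\<^sub>v x)"
  using assms by (intro eq_vecI) auto

text \<open>The witness is the block row of \<open>1\<^sub>m n\<close> and
  \<open>- 1\<^sub>m n\<close>, since every number is its positive part minus its negative
  part.\<close>

lemma merge_mat_exists:
  "\<exists>P :: rmat. P \<in> carrier_mat n (n + n) \<and> (\<forall>x\<in>carrier_vec n. P *\<^sub>v split_vec x = x)"
proof -
  obtain P :: rmat where P: "P \<in> carrier_mat n (n + n)"
    "\<And>x z. x \<in> carrier_vec n \<Longrightarrow> z \<in> carrier_vec n \<Longrightarrow>
       P *\<^sub>v (x @\<^sub>v z) = 1\<^sub>m n *\<^sub>v x + (- 1\<^sub>m n) *\<^sub>v z"
    by (rule append_cols_obtain[of "1\<^sub>m n" n n "- 1\<^sub>m n" n]) auto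
  have "P *\<^sub>v split_vec x = x" if x: "x \<in> carrier_vec n" for x
  proof -
    have "P *\<^sub>v split_vec x = relu x + - relu (- x)"
      using x P(2)[of "relu x" "relu (- x)"]
      by (simp add: split_vec_def relu_append mult_mat_vec_uminus[of _ n n])
    also have "\<dots> = x"
      using x unfolding relu_def by (intro eq_vecI) auto
    finally show ?thesis .
  qed
  with P(1) show ?thesis by blast
qed

text \<open>\<open>net k l p F\<close>: the function \<open>F\<close> on \<open>\<real>\<^sup>k\<close> is the realization of a network
  with output dimension \<open>l\<close> and \<open>p\<close> parameters.\<close>

inductive net :: "nat \<Rightarrow> nat \<Rightarrow> nat \<Rightarrow> (rvec \<Rightarrow> rvec) \<Rightarrow> bool" where
  affine: "1 \<le> k \<Longrightarrow> 1 \<le> l \<Longrightarrow> W \<in> carrier_mat l k \<Longrightarrow> B \<in> carrier_vec l \<Longrightarrow>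
    net k l (l * (k + 1)) (\<lambda>x. W *\<^sub>v x + B)"
| layer: "1 \<le> k \<Longrightarrow> W \<in> carrier_mat m k \<Longrightarrow> B \<in> carrier_vec m \<Longrightarrow> net m l p F \<Longrightarrow>
    net k l (m * (k + 1) + p) (\<lambda>x. F (relu (W *\<^sub>v x + B)))"

lemma net_dims: "net k l p F \<Longrightarrow> 1 \<le> k \<and> 1 \<le> l"
  by (induction rule: net.induct) auto

lemma net_carrier: "net k l p F \<Longrightarrow> x \<in> carrier_vec k \<Longrightarrow> F x \<in> carrier_vec l"
  by (induction arbitrary: x rule: net.induct) auto

section \<open>Layer lists in \<open>ANN\<close> and the predicate \<open>net\<close>\<close>

lemma net_realization:
  assumes "\<forall>k\<le>length \<Phi>. 1 \<le> l k" "\<Phi> \<noteq> []"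
    "\<forall>k<length \<Phi>. fst (\<Phi> ! k) \<in> carrier_mat (l (Suc k)) (l k) \<and>
       snd (\<Phi> ! k) \<in> carrier_vec (l (Suc k))"
  shows "net (l 0) (l (length \<Phi>)) (num_params \<Phi>) (realization \<Phi>)"
  using assms
proof (induction \<Phi> arbitrary: l)
  case (Cons L \<Phi>)
  obtain W B where L: "L = (W, B)" by (cases L)
  have W: "W \<in> carrier_mat (l 1) (l 0)" and B: "B \<in> carrier_vec (l 1)"
    and l: "1 \<le> l 0" "1 \<le> l 1"
    using Cons.prems L by auto
  show ?case
  proof (cases \<Phi>)
    case Nil
    have "realization [(W, B)] = (\<lambda>x. W *\<^sub>v x + B)" by (rule ext) simp
    then show ?thesis
      using net.affine[OF l W B] W Nil L by (simp add: num_params_def)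
  next
    case (Cons L' \<Phi>')
    \<comment> \<open>The tail is a network for the dimension sequence shifted by one, which is why
      the induction leaves \<open>l\<close> arbitrary.\<close>
    have "net (l 1) (l (Suc (length \<Phi>))) (num_params \<Phi>) (realization \<Phi>)"
    proof -
      have "\<forall>k\<le>length \<Phi>. 1 \<le> l (Suc k)" using Cons.prems(1) by simp
      moreover have "\<Phi> \<noteq> []" using Cons by simp
      moreover have "\<forall>k<length \<Phi>. fst (\<Phi> ! k) \<in> carrier_mat (l (Suc (Suc k))) (l (Suc k)) \<and>
        snd (\<Phi> ! k) \<in> carrier_vec (l (Suc (Suc k)))"
      proof (intro allI impI)
        fix k assume "k < length \<Phi>"
        then show "fst (\<Phi> ! k) \<in> carrier_mat (l (Suc (Suc k))) (l (Suc k)) \<and>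
          snd (\<Phi> ! k) \<in> carrier_vec (l (Suc (Suc k)))"
          using Cons.prems(3)[rule_format, of "Suc k"] by simp
      qed
      ultimately show ?thesis using Cons.IH[of "\<lambda>k. l (Suc k)"] by simp
    qed
    from net.layer[OF l(1) W B this]
    have "net (l 0) (l (Suc (length \<Phi>))) (l 1 * (l 0 + 1) + num_params \<Phi>)
       (\<lambda>x. realization \<Phi> (relu (W *\<^sub>v x + B)))" .
    moreover have "realization (L # \<Phi>) = (\<lambda>x. realization \<Phi> (relu (W *\<^sub>v x + B)))"
      by (rule ext) (simp add: L Cons relu_def)
    ultimately show ?thesis using W L by (simp add: num_params_def)
  qed
qed simp

lemma ANN_imp_net:
  assumes "\<Phi> \<in> ANN"
  obtains l where "net (in_dim \<Phi>) l (num_params \<Phi>) (realization \<Phi>)"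
proof -
  from assms obtain L l where L: "1 \<le> L" "\<forall>k\<le>L. 1 \<le> l k" "length \<Phi> = L"
    "\<forall>k<L. fst (\<Phi> ! k) \<in> carrier_mat (l (Suc k)) (l k) \<and>
       snd (\<Phi> ! k) \<in> carrier_vec (l (Suc k))"
    unfolding ANN_def by auto
  then have ne: "\<Phi> \<noteq> []" by auto
  have "in_dim \<Phi> = l 0"
    using L(1,3) ne L(4)[rule_format, of 0] carrier_matD(2) by (auto simp: in_dim_def hd_conv_nth)
  moreover have "net (l 0) (l L) (num_params \<Phi>) (realization \<Phi>)"
    using net_realization[of \<Phi> l] L ne by simp
  ultimately show ?thesis using that[of "l L"] by simp
qed

text \<open>Constructions carried out on functions with \<open>net\<close> thereby yield elements of
  \<open>ANN\<close> of the same size. The induction carries a layer list together with its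
  dimension sequence; a new first layer prepends an entry to both.\<close>

lemma net_imp_ANN:
  assumes "net k l p F"
  obtains \<Phi> where "\<Phi> \<in> ANN" "in_dim \<Phi> = k" "num_params \<Phi> = p" "realization \<Phi> = F"
proof -
  have "\<exists>\<Phi> ls. \<Phi> \<noteq> [] \<and> (\<forall>j\<le>length \<Phi>. 1 \<le> ls j) \<and> ls 0 = k \<and>
    (\<forall>j<length \<Phi>. fst (\<Phi> ! j) \<in> carrier_mat (ls (Suc j)) (ls j) \<and>
       snd (\<Phi> ! j) \<in> carrier_vec (ls (Suc j))) \<and> num_params \<Phi> = p \<and> realization \<Phi> = F"
    using assms
  proof (induction rule: net.induct)
    case (affine k l W B)
    show ?case
      using affine
      by (intro exI[of _ "[(W, B)]"] exI[of _ "\<lambda>j. if j = 0 then k else l"])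
        (auto simp: num_params_def fun_eq_iff)
  next
    case (layer k W m B l p F)
    then obtain \<Phi> ls where IH: "\<Phi> \<noteq> []" "\<forall>j\<le>length \<Phi>. 1 \<le> ls j" "ls 0 = m"
      "\<forall>j<length \<Phi>. fst (\<Phi> ! j) \<in> carrier_mat (ls (Suc j)) (ls j) \<and>
       snd (\<Phi> ! j) \<in> carrier_vec (ls (Suc j))" "num_params \<Phi> = p" "realization \<Phi> = F"
      by blast
    define ls' where "ls' = case_nat k ls"
    obtain L \<Psi> where \<Phi>: "\<Phi> = L # \<Psi>" using IH(1) by (cases \<Phi>) auto
    have "realization ((W, B) # \<Phi>) = (\<lambda>x. F (relu (W *\<^sub>v x + B)))"
      using IH(6) by (auto simp: \<Phi> relu_def)
    moreover have "\<forall>j\<le>length ((W, B) # \<Phi>). 1 \<le> ls' j"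
      using IH(2) layer.hyps(1) by (auto simp: ls'_def split: nat.split)
    moreover
    have "fst (((W, B) # \<Phi>) ! j) \<in> carrier_mat (ls' (Suc j)) (ls' j) \<and>
       snd (((W, B) # \<Phi>) ! j) \<in> carrier_vec (ls' (Suc j))" if "j < length ((W, B) # \<Phi>)" for j
      using that IH(3,4) layer.hyps by (cases j) (auto simp: ls'_def)
    then have "\<forall>j<length ((W, B) # \<Phi>). fst (((W, B) # \<Phi>) ! j) \<in> carrier_mat (ls' (Suc j)) (ls' j) \<and>
       snd (((W, B) # \<Phi>) ! j) \<in> carrier_vec (ls' (Suc j))" by (intro allI impI)
    moreover have "num_params ((W, B) # \<Phi>) = m * (k + 1) + p"
      using IH(5) layer.hyps by (simp add: num_params_def)
    moreover have "ls' 0 = k" by (simp add: ls'_def)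
    ultimately show ?case
      by (intro exI[of _ "(W, B) # \<Phi>"] exI[of _ ls'] conjI) simp_all
  qed
  then obtain \<Phi> ls where *: "\<Phi> \<noteq> []" "\<forall>j\<le>length \<Phi>. 1 \<le> ls j" "ls 0 = k"
    "\<forall>j<length \<Phi>. fst (\<Phi> ! j) \<in> carrier_mat (ls (Suc j)) (ls j) \<and>
       snd (\<Phi> ! j) \<in> carrier_vec (ls (Suc j))" "num_params \<Phi> = p" "realization \<Phi> = F"
    by blast
  have "1 \<le> length \<Phi>" using *(1) by (cases \<Phi>) auto
  with * have "\<Phi> \<in> ANN"
    unfolding ANN_def by (intro UN_I[of "length \<Phi>"] UN_I[of ls]) auto
  moreover have "in_dim \<Phi> = k"
    using *(1,3) *(4)[rule_format, of 0] by (auto simp: in_dim_def hd_conv_nth)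
  ultimately show ?thesis by (rule that[OF _ _ *(5,6)])
qed

section \<open>Composition of networks and its cost in parameters\<close>

text \<open>The matrix is absorbed into the first weight matrix, which becomes \<open>W * M\<close>.
  Only that layer changes size, from \<open>k + 1\<close> to \<open>n + 1\<close> parameters per
  row.\<close>

lemma net_mat_comp:
  assumes "net k l p F" "M \<in> carrier_mat k n" "1 \<le> n"
  shows "\<exists>G q. net n l q G \<and> q \<le> (n + 1) * p \<and> (\<forall>z\<in>carrier_vec n. G z = F (M *\<^sub>v z))"
  using assms(1)
proof cases
  case (affine W B)
  have "net n l (l * (n + 1)) (\<lambda>z. (W * M) *\<^sub>v z + B)"
    using affine assms by (intro net.affine) auto
  moreover have "l * (n + 1) \<le> (n + 1) * p" using affine by (simp add: algebra_simps)
  moreover have "(W * M) *\<^sub>v z + B = F (M *\<^sub>v z)" if "z \<in> carrier_vec n" for z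
    using affine assms(2) that by (simp add: assoc_mult_mat_vec[of _ l k _ n])
  ultimately show ?thesis by blast
next
  case (layer W m B q F')
  have "net n l (m * (n + 1) + q) (\<lambda>z. F' (relu ((W * M) *\<^sub>v z + B)))"
    using layer assms by (intro net.layer) auto
  moreover have "m * (n + 1) + q \<le> (n + 1) * p" using layer
    by (simp add: algebra_simps)
  moreover have "F' (relu ((W * M) *\<^sub>v z + B)) = F (M *\<^sub>v z)" if "z \<in> carrier_vec n" for z
    using layer assms(2) that by (simp add: assoc_mult_mat_vec[of _ m k _ n])
  ultimately show ?thesis by blast
qed

text \<open>The extra nonnegative coordinates \<open>z\<close> pass through every ReLU unchanged.\<close>

lemma net_skip:
  assumes "net k l p F" "C \<in> carrier_mat l n"
  shows "\<exists>G q. net (k + n) l q G \<and> q \<le> (n + 1)\<^sup>2 * p \<and>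
    (\<forall>x\<in>carrier_vec k. \<forall>z\<in>carrier_vec n. (\<forall>i<n. 0 \<le> z $ i) \<longrightarrow>
       G (x @\<^sub>v z) = h \<cdot>\<^sub>v F x + C *\<^sub>v z)"
  using assms
proof (induction rule: net.induct)
  case (affine k l W B)
  \<comment> \<open>The last affine map performs the scaling by \<open>h\<close> and the addition of
    \<open>C z\<close> together, as a block row.\<close>
  obtain M where M: "M \<in> carrier_mat l (k + n)"
    "\<And>x z. x \<in> carrier_vec k \<Longrightarrow> z \<in> carrier_vec n \<Longrightarrow>
      M *\<^sub>v (x @\<^sub>v z) = (h \<cdot>\<^sub>m W) *\<^sub>v x + C *\<^sub>v z"
    using append_cols_obtain[of "h \<cdot>\<^sub>m W" l k C n] affine by auto
  have "net (k + n) l (l * (k + n + 1)) (\<lambda>x. M *\<^sub>v x + h \<cdot>\<^sub>v B)"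
    using affine M by (intro net.affine) auto
  moreover have "l * (k + n + 1) \<le> (n + 1)\<^sup>2 * (l * (k + 1))"
    by (simp add: algebra_simps power2_eq_square)
  moreover have "M *\<^sub>v (x @\<^sub>v z) + h \<cdot>\<^sub>v B = h \<cdot>\<^sub>v (W *\<^sub>v x + B) + C *\<^sub>v z"
    if x: "x \<in> carrier_vec k" and z: "z \<in> carrier_vec n" for x z
    unfolding M(2)[OF x z] using affine x z
    by (intro eq_vecI) (auto simp: algebra_simps)
  ultimately show ?case
    by (intro exI[of _ "\<lambda>x. M *\<^sub>v x + h \<cdot>\<^sub>v B"] exI[of _ "l * (k + n + 1)"] conjI ballI impI)
next
  case (layer k W m B l p F)
  then obtain G q where G: "net (m + n) l q G" "q \<le> (n + 1)\<^sup>2 * p"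
    "\<And>x z. x\<in>carrier_vec m \<Longrightarrow> z\<in>carrier_vec n \<Longrightarrow> \<forall>i<n. 0 \<le> z $ i \<Longrightarrow>
     G (x @\<^sub>v z) = h \<cdot>\<^sub>v F x + C *\<^sub>v z" by blast
  have m: "1 \<le> m" using layer net_dims by blast
  \<comment> \<open>The block diagonal of \<open>W\<close> and an identity carries \<open>z\<close>
    alongside the hidden state.\<close>
  define M where "M = four_block_mat W (0\<^sub>m m n) (0\<^sub>m n k) (1\<^sub>m n)"
  have M: "M \<in> carrier_mat (m + n) (k + n)"
    using layer.hyps unfolding M_def by (intro four_block_carrier_mat) auto
  have "net (k + n) l ((m + n) * (k + n + 1) + q)
    (\<lambda>x. G (relu (M *\<^sub>v x + (B @\<^sub>v 0\<^sub>v n))))"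
    using layer.hyps M G by (intro net.layer) auto
  moreover have "(m + n) * (k + n + 1) + q \<le> (n + 1)\<^sup>2 * (m * (k + 1) + p)"
  proof -
    \<comment> \<open>Uses \<open>1 \<le> m\<close>. Each of the two factors of the layer size grows
      by at most \<open>n + 1\<close>, whence the square.\<close>
    have "m + n \<le> (n + 1) * m" using m by (simp add: algebra_simps)
    moreover have "k + n + 1 \<le> (n + 1) * (k + 1)" by (simp add: algebra_simps)
    ultimately have "(m + n) * (k + n + 1) \<le> ((n + 1) * m) * ((n + 1) * (k + 1))"
      by (rule mult_le_mono)
    with G(2) show ?thesis by (simp add: algebra_simps power2_eq_square)
  qed
  moreover have "G (relu (M *\<^sub>v (x @\<^sub>v z) + (B @\<^sub>v 0\<^sub>v n)))
    = h \<cdot>\<^sub>v F (relu (W *\<^sub>v x + B)) + C *\<^sub>v z"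
    if x: "x \<in> carrier_vec k" and z: "z \<in> carrier_vec n" "\<forall>i<n. 0 \<le> z $ i" for x z
  proof -
    have "M *\<^sub>v (x @\<^sub>v z) + (B @\<^sub>v 0\<^sub>v n) = (W *\<^sub>v x + B) @\<^sub>v z"
      unfolding M_def using layer.hyps x z
      by (subst four_block_mat_mult_vec[of _ m k _ n _ n])
        (auto simp: append_vec_add[of _ m _ _ n])
    moreover have "relu z = z" using z by (intro relu_nonneg) auto
    ultimately show ?thesis
      using G(3)[of "relu (W *\<^sub>v x + B)" z] layer.hyps x z by (simp add: relu_append)
  qed
  ultimately show ?case
    by (intro exI[of _ "\<lambda>x. G (relu (M *\<^sub>v x + (B @\<^sub>v 0\<^sub>v n)))"]
        exI[of _ "(m + n) * (k + n + 1) + q"] conjI ballI impI)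
qed

text \<open>Joining two networks through the hidden state \<open>split_vec\<close> instead of merging the
  affine maps at the seam keeps the size additive in the second network.\<close>

lemma net_split_comp:
  assumes "net k l p F" "net (l + l) m q G"
  shows "\<exists>H r. net k m r H \<and> r \<le> 2 * p + q \<and> (\<forall>x\<in>carrier_vec k. H x = G (split_vec (F x)))"
  using assms
proof (induction rule: net.induct)
  case (affine k l W B)
  \<comment> \<open>Stacking \<open>W\<close> on \<open>- W\<close> turns the output layer into a
    hidden layer with preactivation \<open>F x\<close> followed by \<open>- F x\<close>, whose
    \<open>relu\<close> is \<open>split_vec (F x)\<close>. Only this layer doubles, hence
    \<open>2 * p\<close>.\<close>
  have 1: "(W @\<^sub>r - W) \<in> carrier_mat (l + l) k"
    using affine by (intro carrier_append_rows) auto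
  from net.layer[OF affine(1) this, of "B @\<^sub>v - B" m q G] affine
  have "net k m ((l + l) * (k + 1) + q)
    (\<lambda>x. G (relu ((W @\<^sub>r - W) *\<^sub>v x + (B @\<^sub>v - B))))" by auto
  moreover have "(l + l) * (k + 1) + q \<le> 2 * (l * (k + 1)) + q" by simp
  moreover have "(W @\<^sub>r - W) *\<^sub>v x + (B @\<^sub>v - B) = (W *\<^sub>v x + B) @\<^sub>v - (W *\<^sub>v x + B)"
    if x: "x \<in> carrier_vec k" for x
  proof -
    have "(W @\<^sub>r - W) *\<^sub>v x = W *\<^sub>v x @\<^sub>v - (W *\<^sub>v x)"
      using affine x by (subst mat_mult_append[of _ l k _ l]) (auto simp: mult_mat_vec_uminus)
    moreover have "- (W *\<^sub>v x) + - B = - (W *\<^sub>v x + B)"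
      using affine x by (intro eq_vecI) auto
    ultimately show ?thesis using affine x
      by (simp add: append_vec_add[of _ l _ _ l])
  qed
  ultimately show ?case unfolding split_vec_def
    by (intro exI[of _ "\<lambda>x. G (relu ((W @\<^sub>r - W) *\<^sub>v x + (B @\<^sub>v - B)))"]
        exI[of _ "(l + l) * (k + 1) + q"]) simp
next
  case (layer k W n B l p F)
  then obtain H r where H: "net n m r H" "r \<le> 2 * p + q"
    "\<forall>x\<in>carrier_vec n. H x = G (split_vec (F x))"
    by blast
  have "net k m (n * (k + 1) + r) (\<lambda>x. H (relu (W *\<^sub>v x + B)))"
    using layer.hyps H by (intro net.layer) auto
  moreover have "n * (k + 1) + r \<le> 2 * (n * (k + 1) + p) + q" using H(2) by simp
  moreover have "\<forall>x\<in>carrier_vec k. H (relu (W *\<^sub>v x + B)) = G (split_vec (F (relu (W *\<^sub>v x + B))))"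
    using H(3) layer.hyps by auto
  ultimately show ?case
    by (intro exI[of _ "\<lambda>x. H (relu (W *\<^sub>v x + B))"] exI[of _ "n * (k + 1) + r"] conjI)
qed

text \<open>The matrix \<open>P\<close> recovers \<open>x\<close> from the split state
  \<open>z\<close>. Stacked on an identity it feeds \<open>x\<close> to \<open>\<phi>\<close> and
  sends \<open>z\<close> past it, and \<open>P z\<close> restores the summand \<open>x\<close> at
  the end. The cube is \<open>(2 * d + 1)\<^sup>2\<close> for the bypass times
  \<open>2 * d + 1\<close> for the precomposition.\<close>

lemma net_euler_step:
  assumes "net d d p \<phi>"
  shows "\<exists>S q. net (d + d) d q S \<and> q \<le> (2 * d + 1) ^ 3 * p \<and>
    (\<forall>x\<in>carrier_vec d. S (split_vec x) = x + h \<cdot>\<^sub>v \<phi> x)"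
proof -
  have d: "1 \<le> d" "1 \<le> d + d" using net_dims[OF assms(1)] by simp_all
  obtain P :: rmat where P: "P \<in> carrier_mat d (d + d)"
    "\<forall>x\<in>carrier_vec d. P *\<^sub>v split_vec x = x" using merge_mat_exists[of d] by blast
  obtain G q where G: "net (d + (d + d)) d q G" "q \<le> ((d + d) + 1)\<^sup>2 * p"
    "\<forall>x\<in>carrier_vec d. \<forall>z\<in>carrier_vec (d + d). (\<forall>i<d + d. 0 \<le> z $ i) \<longrightarrow>
       G (x @\<^sub>v z) = h \<cdot>\<^sub>v \<phi> x + P *\<^sub>v z"
    using net_skip[OF assms P(1), of h] by blast
  have Q: "P @\<^sub>r 1\<^sub>m (d + d) \<in> carrier_mat (d + (d + d)) (d + d)"
    using P by (intro carrier_append_rows) auto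
  obtain S r where S: "net (d + d) d r S" "r \<le> ((d + d) + 1) * q"
    "\<forall>z\<in>carrier_vec (d + d). S z = G ((P @\<^sub>r 1\<^sub>m (d + d)) *\<^sub>v z)"
    using net_mat_comp[OF G(1) Q d(2)] by blast
  have "S (split_vec x) = x + h \<cdot>\<^sub>v \<phi> x" if x: "x \<in> carrier_vec d" for x
  proof -
    have c: "split_vec x \<in> carrier_vec (d + d)" using x by simp
    have "(P @\<^sub>r 1\<^sub>m (d + d)) *\<^sub>v split_vec x = x @\<^sub>v split_vec x"
      using mat_mult_append[OF P(1) one_carrier_mat c] P(2)[rule_format, OF x] c by simp
    then show ?thesis
      using S(3)[rule_format, OF c] G(3)[rule_format, OF x c] split_vec_nonneg[of _ x] c P(2)[rule_format, OF x] net_carrier[OF assms x] x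
      by (auto simp: comm_add_vec[of _ d])
  qed
  moreover have "r \<le> (2 * d + 1) ^ 3 * p"
  proof -
    have "r \<le> (2 * d + 1) * ((2 * d + 1)\<^sup>2 * p)"
      using S(2) mult_le_mono2[OF G(2), of "2 * d + 1"] by (simp add: mult_2)
    then show ?thesis by (simp only: power2_eq_square power3_eq_cube mult.assoc)
  qed
  ultimately show ?thesis using S(1) by blast
qed

text \<open>The three summands of the size bound belong to an identity layer that creates the first
  split state, to the \<open>N\<close> Euler steps, and to \<open>\<Psi>\<close> reading the last
  split state through \<open>P\<close>. As the seams pass through \<open>split_vec\<close>, the
  costs of the steps add up instead of multiplying.\<close>

lemma net_euler:
  assumes "net d d p \<phi>" "net d m r \<Psi>"
  shows "\<exists>G q. net d m q G \<and>
    q \<le> 2 * (d * (d + 1)) + N * (2 * ((2 * d + 1) ^ 3 * p)) + (2 * d + 1) * r \<and>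
    (\<forall>x\<in>carrier_vec d. G x = \<Psi> (((\<lambda>y. y + h \<cdot>\<^sub>v \<phi> y) ^^ N) x))"
proof -
  have d: "1 \<le> d" "1 \<le> d + d" using net_dims[OF assms(1)] by simp_all
  obtain P :: rmat where P: "P \<in> carrier_mat d (d + d)"
    "\<forall>x\<in>carrier_vec d. P *\<^sub>v split_vec x = x" using merge_mat_exists[of d] by blast
  obtain S s where S: "net (d + d) d s S" "s \<le> (2 * d + 1) ^ 3 * p"
    "\<forall>x\<in>carrier_vec d. S (split_vec x) = x + h \<cdot>\<^sub>v \<phi> x"
    using net_euler_step[OF assms(1), of h] by blast
  have "\<exists>G q. net (d + d) m q G \<and> q \<le> N * (2 * ((2 * d + 1) ^ 3 * p)) + (2 * d + 1) * r \<and>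
    (\<forall>x\<in>carrier_vec d. G (split_vec x) = \<Psi> (((\<lambda>y. y + h \<cdot>\<^sub>v \<phi> y) ^^ N) x))"
  proof (induction N)
    case 0
    obtain G q where "net (d + d) m q G" "q \<le> (d + d + 1) * r"
      "\<forall>z\<in>carrier_vec (d + d). G z = \<Psi> (P *\<^sub>v z)"
      using net_mat_comp[OF assms(2) P(1) d(2)] by blast
    then show ?case using P(2) by (intro exI[of _ G] exI[of _ q]) (simp add: mult_2)
  next
    case (Suc N)
    then obtain G q where G: "net (d + d) m q G"
      "q \<le> N * (2 * ((2 * d + 1) ^ 3 * p)) + (2 * d + 1) * r"
      "\<forall>x\<in>carrier_vec d. G (split_vec x) = \<Psi> (((\<lambda>y. y + h \<cdot>\<^sub>v \<phi> y) ^^ N) x)" by blast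
    \<comment> \<open>The new step goes in front of the network for \<open>N\<close> steps, so the
      iterate is unrolled from the inside.\<close>
    obtain H t where H: "net (d + d) m t H" "t \<le> 2 * s + q"
      "\<forall>x\<in>carrier_vec (d + d). H x = G (split_vec (S x))"
      using net_split_comp[OF S(1) G(1)] by blast
    have "H (split_vec x) = \<Psi> (((\<lambda>y. y + h \<cdot>\<^sub>v \<phi> y) ^^ Suc N) x)" if x: "x \<in> carrier_vec d" for x
    proof -
      have "x + h \<cdot>\<^sub>v \<phi> x \<in> carrier_vec d" using x net_carrier[OF assms(1) x] by simp
      then show ?thesis
        using H(3) S(3)[rule_format, OF x] G(3) x
        by (simp add: funpow_Suc_right del: funpow.simps)
    qed
    moreover have "t \<le> Suc N * (2 * ((2 * d + 1) ^ 3 * p)) + (2 * d + 1) * r"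
      using H(2) S(2) G(2) by simp
    ultimately show ?case using H(1) by blast
  qed
  then obtain G q where G: "net (d + d) m q G"
    "q \<le> N * (2 * ((2 * d + 1) ^ 3 * p)) + (2 * d + 1) * r"
    "\<forall>x\<in>carrier_vec d. G (split_vec x) = \<Psi> (((\<lambda>y. y + h \<cdot>\<^sub>v \<phi> y) ^^ N) x)" by blast
  obtain H t where H: "net d m t H" "t \<le> 2 * (d * (d + 1)) + q"
    "\<forall>x\<in>carrier_vec d. H x = G (split_vec (1\<^sub>m d *\<^sub>v x + 0\<^sub>v d))"
    using net_split_comp[OF net.affine[OF d(1) d(1) one_carrier_mat zero_carrier_vec] G(1)] by blast
  then have "\<forall>x\<in>carrier_vec d. H x = \<Psi> (((\<lambda>y. y + h \<cdot>\<^sub>v \<phi> y) ^^ N) x)"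
    using G(3) by simp
  with H(1,2) G(2) show ?thesis by (intro exI[of _ H] exI[of _ t]) simp
qed

section \<open>Continuity of network realizations\<close>

lemma continuous_map_vec_index:
  assumes "i < d"
  shows "continuous_map (Rtop d) euclideanreal (\<lambda>x. x $ i)"
proof -
  interpret Metric_space "carrier_vec d" "euclid_dist d" by (rule Metric_space_euclid_dist)
  have "Lipschitz_continuous_map (metric (carrier_vec d, euclid_dist d)) euclidean_metric (\<lambda>x. x $ i)"
    unfolding Lipschitz_continuous_map_def
  proof (intro conjI exI[of _ 1] ballI)
    fix x y assume "x \<in> mspace (metric (carrier_vec d, euclid_dist d))" "y \<in> mspace (metric (carrier_vec d, euclid_dist d))"
    then have "x \<in> carrier_vec d" "y \<in> carrier_vec d" by simp_all
    then show "mdist euclidean_metric (x $ i) (y $ i) \<le> 1 * mdist (metric (carrier_vec d, euclid_dist d)) x y"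
      using index_le_vnorm[of i "x - y"] assms by (simp add: euclid_dist_eq_vnorm dist_real_def)
  qed simp
  from Lipschitz_continuous_imp_continuous_map[OF this] show ?thesis
    by (simp add: mtopology_of Rtop_def)
qed

text \<open>\<open>G\<close> factors through the product topology, where continuity is
  componentwise, followed by \<open>Matrix.vec l\<close>.\<close>

lemma continuous_map_into_Rtop:
  assumes G: "\<And>x. x \<in> topspace X \<Longrightarrow> G x \<in> carrier_vec l"
    and cont: "\<And>i. i < l \<Longrightarrow> continuous_map X euclideanreal (\<lambda>x. G x $ i)"
  shows "continuous_map X (Rtop l) G"
proof -
  have "continuous_map X (product_topology (\<lambda>_. euclideanreal) {..<l}) (\<lambda>x. restrict (vec_index (G x)) {..<l})"
    unfolding continuous_map_componentwise using cont by auto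
  from continuous_map_compose[OF this continuous_map_vec]
  have "continuous_map X (Rtop l) (\<lambda>x. Matrix.vec l (restrict (vec_index (G x)) {..<l}))"
    by (simp add: o_def)
  moreover have "Matrix.vec l (restrict (vec_index (G x)) {..<l}) = G x" if "x \<in> topspace X" for x
    using carrier_vecD[OF G[OF that]] by (intro eq_vecI) simp_all
  ultimately show ?thesis by (rule continuous_map_eq)
qed

lemma continuous_map_affine:
  assumes W: "W \<in> carrier_mat l k" and B: "B \<in> carrier_vec l" and i: "i < l"
  shows "continuous_map (Rtop k) euclideanreal (\<lambda>x. (W *\<^sub>v x + B) $ i)"
proof -
  have "continuous_map (Rtop k) euclideanreal (\<lambda>x. (\<Sum>j<k. W $$ (i, j) * x $ j) + B $ i)"
    by (intro continuous_intros continuous_map_vec_index) auto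
  moreover have "(\<Sum>j<k. W $$ (i, j) * x $ j) + B $ i = (W *\<^sub>v x + B) $ i" if "x \<in> topspace (Rtop k)" for x
    using that W B i by (simp add: topspace_Rtop scalar_prod_def atLeast0LessThan)
  ultimately show ?thesis by (rule continuous_map_eq)
qed

lemma Cont_carrier: "h \<in> Cont k l \<Longrightarrow> x \<in> carrier_vec k \<Longrightarrow> h x \<in> carrier_vec l"
  unfolding Cont_def using continuous_map_image_subset_topspace[of "Rtop k" "Rtop l" h]
  by (auto simp: topspace_Rtop)

text \<open>The dimension of \<open>h (0\<^sub>v k)\<close> decides. This identifies the
  existentially quantified output dimension in \<open>approx_space\<close> with the known
  one.\<close>

lemma Cont_unique_dim: "h \<in> Cont k l \<Longrightarrow> h \<in> Cont k l' \<Longrightarrow> l = l'"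
  using Cont_carrier[of h k l "0\<^sub>v k"] Cont_carrier[of h k l' "0\<^sub>v k"]
  by (metis carrier_vecD zero_carrier_vec)

lemma net_Cont: "net k l p F \<Longrightarrow> F \<in> Cont k l"
  unfolding Cont_def mem_Collect_eq
proof (induction rule: net.induct)
  case (affine k l W B)
  then show ?case
    by (intro continuous_map_into_Rtop continuous_map_affine) (auto simp: topspace_Rtop)
next
  case (layer k W m B l p F)
  have "continuous_map (Rtop k) (Rtop m) (\<lambda>x. relu (W *\<^sub>v x + B))"
  proof (rule continuous_map_into_Rtop)
    fix x assume "x \<in> topspace (Rtop k)"
    then show "relu (W *\<^sub>v x + B) \<in> carrier_vec m" using layer.hyps by (simp add: topspace_Rtop)
  next
    fix i assume i: "i < m"
    have "continuous_map (Rtop k) euclideanreal (\<lambda>x. max ((W *\<^sub>v x + B) $ i) 0)"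
      using layer.hyps i by (intro continuous_map_real_max continuous_map_affine) auto
    moreover have "max ((W *\<^sub>v x + B) $ i) 0 = relu (W *\<^sub>v x + B) $ i" for x
      using layer.hyps i by (simp add: relu_def)
    ultimately show "continuous_map (Rtop k) euclideanreal (\<lambda>x. relu (W *\<^sub>v x + B) $ i)" by simp
  qed
  from continuous_map_compose[OF this layer.IH] show ?case by (simp add: o_def)
qed

section \<open>Euler polygons\<close>

definition euler :: "(rvec \<Rightarrow> rvec) \<Rightarrow> real \<Rightarrow> nat \<Rightarrow> rvec \<Rightarrow> rvec" where
  "euler \<phi> h n = (\<lambda>y. y + h \<cdot>\<^sub>v \<phi> y) ^^ n"

lemma euler_0 [simp]: "euler \<phi> h 0 x = x"
  by (simp add: euler_def)

lemma euler_Suc [simp]: "euler \<phi> h (Suc n) x = euler \<phi> h n x + h \<cdot>\<^sub>v \<phi> (euler \<phi> h n x)"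
  by (simp add: euler_def)

lemma euler_carrier:
  assumes "\<phi> \<in> carrier_vec d \<rightarrow> carrier_vec d" "x \<in> carrier_vec d"
  shows "euler \<phi> h n x \<in> carrier_vec d"
  using assms(2) funcset_mem[OF assms(1)] by (induction n) auto

text \<open>A discrete Gronwall argument: the induction closes with the factor
  \<open>(1 + h * c) ^ n\<close>, and \<open>1 + h * c \<le> exp (h * c)\<close> leaves a bound that
  depends on the steps only through the elapsed time \<open>real n * h\<close>.\<close>

lemma vnorm_euler_le:
  assumes \<phi>: "\<phi> \<in> carrier_vec d \<rightarrow> carrier_vec d" and x: "x \<in> carrier_vec d"
    and h: "0 \<le> h" and c: "0 \<le> c" and b: "0 \<le> b"
    and growth: "\<And>y. y \<in> carrier_vec d \<Longrightarrow> vnorm (\<phi> y) \<le> c * vnorm y + b"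
  shows "vnorm (euler \<phi> h n x) \<le> exp (real n * h * c) * (vnorm x + real n * h * b)"
proof -
  have "vnorm (euler \<phi> h n x) \<le> (1 + h * c) ^ n * (vnorm x + real n * h * b)"
  proof (induction n)
    case (Suc n)
    let ?y = "euler \<phi> h n x" and ?X = "vnorm x + real n * h * b"
    have y: "?y \<in> carrier_vec d" by (rule euler_carrier[OF \<phi> x])
    have "vnorm (euler \<phi> h (Suc n) x) \<le> vnorm ?y + h * vnorm (\<phi> ?y)"
      using vnorm_triangle[OF y, of "h \<cdot>\<^sub>v \<phi> ?y"] \<phi> y h by (auto simp: vnorm_smult)
    also have "\<dots> \<le> (1 + h * c) * vnorm ?y + h * b"
      using mult_left_mono[OF growth[OF y] h] by (simp add: algebra_simps)
    also have "\<dots> \<le> (1 + h * c) * ((1 + h * c) ^ n * ?X) + (1 + h * c) ^ Suc n * (h * b)"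
    proof (rule add_mono)
      show "(1 + h * c) * vnorm ?y \<le> (1 + h * c) * ((1 + h * c) ^ n * ?X)"
        using Suc h c by (intro mult_left_mono) auto
      have "1 \<le> (1 + h * c) ^ Suc n" using h c by (intro one_le_power) auto
      from mult_right_mono[OF this, of "h * b"]
      show "h * b \<le> (1 + h * c) ^ Suc n * (h * b)" using h b by simp
    qed
    finally show ?case by (simp add: algebra_simps)
  qed simp
  also have "\<dots> \<le> exp (real n * h * c) * (vnorm x + real n * h * b)"
  proof (rule mult_right_mono)
    have "(1 + h * c) ^ n \<le> exp (h * c) ^ n"
      using h c by (intro power_mono exp_ge_add_one_self) auto
    then show "(1 + h * c) ^ n \<le> exp (real n * h * c)"
      by (simp add: mult.assoc flip: exp_of_nat_mult)
  qed (use h b in simp)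
  finally show ?thesis .
qed

locale lipschitz_field =
  fixes c :: real and d :: nat and g :: "rvec \<Rightarrow> rvec"
  assumes c: "0 < c"
    and g: "g \<in> carrier_vec d \<rightarrow> carrier_vec d"
    and g_lip: "\<And>x y. x \<in> carrier_vec d \<Longrightarrow> y \<in> carrier_vec d \<Longrightarrow> vnorm (g x - g y) \<le> c * vnorm (x - y)"
begin

lemma g_carrier [simp]: "x \<in> carrier_vec d \<Longrightarrow> g x \<in> carrier_vec d"
  using g by auto

lemma euler_g_carrier [simp]: "x \<in> carrier_vec d \<Longrightarrow> euler g h n x \<in> carrier_vec d"
  by (rule euler_carrier[OF g])

text \<open>One step has Lipschitz constant \<open>1 + h * c\<close>, at most
  \<open>exp (h * c)\<close>. The product depends only on the elapsed time, so it survives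
  refinement of the steps.\<close>

lemma euler_lipschitz:
  assumes xy: "x \<in> carrier_vec d" "y \<in> carrier_vec d" and h: "0 \<le> h"
  shows "vnorm (euler g h n x - euler g h n y) \<le> exp (real n * h * c) * vnorm (x - y)"
proof (induction n)
  case (Suc n)
  let ?x = "euler g h n x" and ?y = "euler g h n y"
  have C: "?x \<in> carrier_vec d" "?y \<in> carrier_vec d" using xy by auto
  have "euler g h (Suc n) x - euler g h (Suc n) y = (?x - ?y) + h \<cdot>\<^sub>v (g ?x - g ?y)"
    using C g_carrier[OF C(1)] g_carrier[OF C(2)]
    by (intro eq_vecI) (auto simp: algebra_simps simp del: g_carrier)
  then have "vnorm (euler g h (Suc n) x - euler g h (Suc n) y) \<le> vnorm (?x - ?y) + h * vnorm (g ?x - g ?y)"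
    using vnorm_triangle[of "?x - ?y" d "h \<cdot>\<^sub>v (g ?x - g ?y)"] C h by (simp add: vnorm_smult)
  also have "\<dots> \<le> (1 + h * c) * vnorm (?x - ?y)"
    using mult_left_mono[OF g_lip[OF C] h] by (simp add: algebra_simps)
  also have "\<dots> \<le> exp (h * c) * (exp (real n * h * c) * vnorm (x - y))"
    using Suc h c by (intro mult_mono exp_ge_add_one_self) auto
  finally show ?case by (simp add: algebra_simps exp_add)
qed simp

text \<open>Each step moves by \<open>h\<close> times the field at the current point, which differs
  from \<open>g y\<close> by at most \<open>c\<close> times the displacement so far. The bound keeps
  all refinements of a polygon in one bounded set.\<close>

lemma euler_displacement:
  assumes y: "y \<in> carrier_vec d" and h: "0 \<le> h"
  shows "vnorm (euler g h n y - y) \<le> real n * h * vnorm (g y) * exp (real n * h * c)"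
proof (induction n)
  case 0
  have "y - y = 0 \<cdot>\<^sub>v y" using y by (intro eq_vecI) auto
  then show ?case by (simp add: vnorm_smult)
next
  case (Suc n)
  let ?x = "euler g h n y" and ?E = "exp (real n * h * c)"
  have C: "?x \<in> carrier_vec d" using y by auto
  have "euler g h (Suc n) y - y = (?x - y) + h \<cdot>\<^sub>v g ?x"
    using C y g_carrier[OF C] by (intro eq_vecI) (auto simp: algebra_simps simp del: g_carrier)
  then have "vnorm (euler g h (Suc n) y - y) \<le> vnorm (?x - y) + h * vnorm (g ?x)"
    using vnorm_triangle[of "?x - y" d "h \<cdot>\<^sub>v g ?x"] C y h by (simp add: vnorm_smult)
  also have "\<dots> \<le> vnorm (?x - y) + h * (vnorm (g y) + c * vnorm (?x - y))"
    using vnorm_le_diff[of "g ?x" d "g y"] g_lip[OF C y] C y h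
    by (intro add_left_mono mult_left_mono) auto
  also have "\<dots> = (1 + h * c) * vnorm (?x - y) + h * vnorm (g y)"
    by (simp add: algebra_simps)
  also have "\<dots> \<le> exp (h * c) * (real n * h * vnorm (g y) * ?E) + (exp (h * c) * ?E) * (h * vnorm (g y))"
  proof (rule add_mono)
    show "(1 + h * c) * vnorm (?x - y) \<le> exp (h * c) * (real n * h * vnorm (g y) * ?E)"
      using Suc h c by (intro mult_mono exp_ge_add_one_self) auto
    have "1 \<le> exp (h * c) * ?E" using h c by (simp flip: exp_add)
    from mult_right_mono[OF this, of "h * vnorm (g y)"]
    show "h * vnorm (g y) \<le> (exp (h * c) * ?E) * (h * vnorm (g y))" using h by simp
  qed
  finally show ?case by (simp add: algebra_simps exp_add)
qed

text \<open>Compares \<open>n\<close> short steps with a single step of the same total length. The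
  deviation of the field from \<open>g y\<close> is controlled by \<open>euler_displacement\<close>;
  the result is quadratic in the total length and uniform in \<open>n\<close>, so it passes to the
  limit of infinitely many steps.\<close>

lemma euler_refine:
  assumes y: "y \<in> carrier_vec d" and h: "0 \<le> h"
  shows "vnorm (euler g h n y - (y + (real n * h) \<cdot>\<^sub>v g y)) \<le>
    c * (real n * h)\<^sup>2 * vnorm (g y) * exp (real n * h * c)"
proof (induction n)
  case 0
  have "y - (y + 0 \<cdot>\<^sub>v g y) = 0 \<cdot>\<^sub>v y"
    using carrier_vecD[OF y] carrier_vecD[OF g_carrier[OF y]] by (intro eq_vecI) (simp_all del: g_carrier)
  then show ?case by (simp add: vnorm_smult)
next
  case (Suc n)
  let ?x = "euler g h n y" and ?E = "exp (real n * h * c)" and ?z = "y + (real n * h) \<cdot>\<^sub>v g y"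
  have C: "?x \<in> carrier_vec d" using y by auto
  have "euler g h (Suc n) y - (y + (real (Suc n) * h) \<cdot>\<^sub>v g y) = (?x - ?z) + h \<cdot>\<^sub>v (g ?x - g y)"
    using C y g_carrier[OF C] g_carrier[OF y]
    by (intro eq_vecI) (auto simp: algebra_simps simp del: g_carrier)
  then have "vnorm (euler g h (Suc n) y - (y + (real (Suc n) * h) \<cdot>\<^sub>v g y)) \<le>
      vnorm (?x - ?z) + h * vnorm (g ?x - g y)"
    using vnorm_triangle[of "?x - ?z" d "h \<cdot>\<^sub>v (g ?x - g y)"] C y h by (simp add: vnorm_smult)
  also have "\<dots> \<le> c * (real n * h)\<^sup>2 * vnorm (g y) * ?E + h * (c * (real n * h * vnorm (g y) * ?E))"
  proof (intro add_mono mult_left_mono)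
    have "c * vnorm (?x - y) \<le> c * (real n * h * vnorm (g y) * ?E)"
      using euler_displacement[OF y h, of n] c by (intro mult_left_mono) auto
    then show "vnorm (g ?x - g y) \<le> c * (real n * h * vnorm (g y) * ?E)"
      using g_lip[OF C y] by linarith
  qed (use Suc h in auto)
  \<comment> \<open>The old error contributes \<open>n\<^sup>2\<close> and the new step
    \<open>n\<close>; their sum \<open>n * (n + 1)\<close> is at most the square of
    \<open>n + 1\<close>.\<close>
  also have "\<dots> = (c * h\<^sup>2 * vnorm (g y)) * (real n * (real n + 1)) * ?E"
    by (simp add: algebra_simps power2_eq_square)
  also have "\<dots> \<le> (c * h\<^sup>2 * vnorm (g y)) * (real (Suc n))\<^sup>2 * exp (real (Suc n) * h * c)"
    using c h by (intro mult_mono) (auto simp: power2_eq_square algebra_simps)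
  finally show ?case by (simp add: algebra_simps power2_eq_square)
qed

end

section \<open>Solutions of the transport equation along Euler polygons\<close>

locale transport = lipschitz_field +
  fixes T :: real and w :: "real \<Rightarrow> rvec \<Rightarrow> real"
  assumes T: "0 < T"
    and w: "w \<in> C1_cyl T d"
    and w_init: "\<And>x y. x \<in> carrier_vec d \<Longrightarrow> y \<in> carrier_vec d \<Longrightarrow>
      \<bar>w 0 x - w 0 y\<bar> \<le> c * vnorm (x - y)"
    and pde: "\<And>t x. t \<in> {0..T} \<Longrightarrow> x \<in> carrier_vec d \<Longrightarrow>
      partial_t T w t x = scalar_prod (grad_x d (w t) x) (g x)"
begin

lemma pde_sum:
  assumes "t \<in> {0..T}" "x \<in> carrier_vec d"
  shows "partial_t T w t x = (\<Sum>i<d. partial_x d i (w t) x * g x $ i)"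
  using pde[OF assms] carrier_vecD[OF g_carrier[OF assms(2)]]
  by (simp add: scalar_prod_def grad_x_def atLeast0LessThan del: g_carrier)

text \<open>Along a characteristic direction the first-order increment of \<open>w\<close> vanishes by the
  transport equation.\<close>

lemma characteristic_increment:
  assumes e: "0 < e"
  shows "\<exists>\<delta>>0. \<forall>s r v. v \<in> carrier_vec d \<longrightarrow> 0 \<le> r \<longrightarrow> 0 \<le> s - r \<longrightarrow> s \<le> T \<longrightarrow> r < \<delta> \<longrightarrow>
    r * vnorm (g v) < \<delta> \<longrightarrow> vnorm v + r * vnorm (g v) \<le> R \<longrightarrow>
    \<bar>w (s - r) (v + r \<cdot>\<^sub>v g v) - w s v\<bar> \<le> r * e * (1 + (\<Sum>i<d. \<bar>g v $ i\<bar>))"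
proof -
  have "\<exists>\<delta>>0. \<forall>s\<in>{0..T}. \<forall>s'\<in>{0..T}. \<forall>x\<in>carrier_vec d. \<forall>x'\<in>carrier_vec d.
    vnorm x \<le> R \<longrightarrow> vnorm x' \<le> R \<longrightarrow> \<bar>s - s'\<bar> < \<delta> \<longrightarrow> vnorm (x - x') < \<delta> \<longrightarrow>
    \<bar>partial_t T w s x - partial_t T w s' x'\<bar> < e"
    using w e unfolding C1_cyl_def by (intro uniformly_continuous_cylinder) simp_all
  then obtain \<delta>t where \<delta>t: "0 < \<delta>t" "\<And>s s' x x'. s\<in>{0..T} \<Longrightarrow> s'\<in>{0..T} \<Longrightarrow> x\<in>carrier_vec d \<Longrightarrow>
      x'\<in>carrier_vec d \<Longrightarrow> vnorm x \<le> R \<Longrightarrow> vnorm x' \<le> R \<Longrightarrow> \<bar>s - s'\<bar> < \<delta>t \<Longrightarrow> vnorm (x - x') < \<delta>t \<Longrightarrow>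
      \<bar>partial_t T w s x - partial_t T w s' x'\<bar> < e"
    by blast
  have "\<forall>i\<in>{..<d}. \<exists>\<delta>>0. \<forall>s\<in>{0..T}. \<forall>s'\<in>{0..T}. \<forall>x\<in>carrier_vec d. \<forall>x'\<in>carrier_vec d.
    vnorm x \<le> R \<longrightarrow> vnorm x' \<le> R \<longrightarrow> \<bar>s - s'\<bar> < \<delta> \<longrightarrow> vnorm (x - x') < \<delta> \<longrightarrow>
    \<bar>partial_x d i (w s) x - partial_x d i (w s') x'\<bar> < e"
    using w e unfolding C1_cyl_def by (intro ballI uniformly_continuous_cylinder) simp_all
  from bchoice[OF this] obtain \<delta>x where \<delta>x0: "\<forall>i\<in>{..<d}. 0 < \<delta>x i \<and> (\<forall>s\<in>{0..T}. \<forall>s'\<in>{0..T}.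
    \<forall>x\<in>carrier_vec d. \<forall>x'\<in>carrier_vec d.
    vnorm x \<le> R \<longrightarrow> vnorm x' \<le> R \<longrightarrow> \<bar>s - s'\<bar> < \<delta>x i \<longrightarrow> vnorm (x - x') < \<delta>x i \<longrightarrow>
    \<bar>partial_x d i (w s) x - partial_x d i (w s') x'\<bar> < e)" ..
  have \<delta>x: "0 < \<delta>x i" "\<And>s x x'. s \<in> {0..T} \<Longrightarrow> x\<in>carrier_vec d \<Longrightarrow>
      x'\<in>carrier_vec d \<Longrightarrow> vnorm x \<le> R \<Longrightarrow> vnorm x' \<le> R \<Longrightarrow> vnorm (x - x') < \<delta>x i \<Longrightarrow>
      \<bar>partial_x d i (w s) x - partial_x d i (w s) x'\<bar> < e" if "i < d" for i
  proof -
    show *: "0 < \<delta>x i" using \<delta>x0 that by simp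
    fix s x x'
    assume "s \<in> {0..T}" "x\<in>carrier_vec d" "x'\<in>carrier_vec d" "vnorm x \<le> R" "vnorm x' \<le> R"
      "vnorm (x - x') < \<delta>x i"
    then show "\<bar>partial_x d i (w s) x - partial_x d i (w s) x'\<bar> < e"
      using bspec[OF \<delta>x0 lessThan_iff[THEN iffD2, OF that], THEN conjunct2, rule_format, of s s x x'] *
      by simp
  qed
  \<comment> \<open>A finite minimum serves the time derivative and all space derivatives at once;
    inserting \<open>\<delta>t\<close> keeps the set nonempty.\<close>
  define \<delta> where "\<delta> = Min (insert \<delta>t (\<delta>x ` {..<d}))"
  have \<delta>0: "0 < \<delta>" using \<delta>t(1) \<delta>x(1) by (simp add: \<delta>_def)
  have le: "\<delta> \<le> \<delta>t" "\<And>i. i < d \<Longrightarrow> \<delta> \<le> \<delta>x i" by (simp_all add: \<delta>_def)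
  have "\<bar>w (s - r) (v + r \<cdot>\<^sub>v g v) - w s v\<bar> \<le> r * e * (1 + (\<Sum>i<d. \<bar>g v $ i\<bar>))"
    if v: "v \<in> carrier_vec d" and r: "0 \<le> r" "0 \<le> s - r" "s \<le> T"
      and small: "r < \<delta>" "r * vnorm (g v) < \<delta>" "vnorm v + r * vnorm (g v) \<le> R" for s r v
  proof -
    have s: "s \<in> {0..T}" using r by simp
    have "0 \<le> r * vnorm (g v)" using r by simp
    then have vR: "vnorm v \<le> R" using small by linarith
    have "\<bar>w (s - r) (v + r \<cdot>\<^sub>v g v) - w s v -
       r * ((\<Sum>i<d. partial_x d i (w s) v * g v $ i) - partial_t T w s v)\<bar> \<le>
       r * e * (1 + (\<Sum>i<d. \<bar>g v $ i\<bar>))"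
    proof (rule C1_cyl_increment[OF w v g_carrier[OF v] r small])
      fix s' x
      assume "s' \<in> {0..T}" "x \<in> carrier_vec d" "vnorm x \<le> R" "\<bar>s' - s\<bar> < \<delta>" "vnorm (x - v) < \<delta>"
      then have "\<bar>partial_t T w s' x - partial_t T w s v\<bar> < e"
        using v vR s le(1) by (intro \<delta>t(2)) auto
      then show "\<bar>partial_t T w s' x - partial_t T w s v\<bar> \<le> e" by simp
    next
      fix x i
      assume i: "x \<in> carrier_vec d" "vnorm x \<le> R" "i < d" "vnorm (x - v) < \<delta>"
      have "\<bar>partial_x d i (w s) x - partial_x d i (w s) v\<bar> < e"
        using i v vR s le(2)[OF i(3)] by (intro \<delta>x(2)) auto
      then show "\<bar>partial_x d i (w s) x - partial_x d i (w s) v\<bar> \<le> e" by simp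
    qed
    then show ?thesis by (simp add: pde_sum[OF s v])
  qed
  with \<delta>0 show ?thesis by (intro exI[of _ \<delta>]) simp
qed

text \<open>Time runs back while space advances along \<open>g\<close>. By
  \<open>characteristic_increment\<close> each short step changes \<open>w\<close> by a small
  multiple of its length, and the lengths add up to the fixed \<open>h\<close>, so the total change
  tends to zero.\<close>

lemma euler_tendsto:
  assumes y: "y \<in> carrier_vec d" and h: "0 \<le> h" "h \<le> s" "s \<le> T"
  shows "(\<lambda>m. w (s - h) (euler g (h / real (Suc m)) (Suc m) y)) \<longlonglongrightarrow> w s y"
proof (rule LIMSEQ_I)
  fix \<epsilon> :: real assume \<epsilon>: "0 < \<epsilon>"
  \<comment> \<open>Uniformly in the number of steps, \<open>D\<close> bounds the distance of the
    polygon from \<open>y\<close>, \<open>B\<close> the field on it, and \<open>R\<close> the norm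
    of its points plus the length of one further step.\<close>
  define D where "D = h * vnorm (g y) * exp (h * c)"
  define B where "B = vnorm (g y) + c * D"
  define R where "R = vnorm y + D + h * B"
  have D0: "0 \<le> D" using h by (simp add: D_def)
  have B0: "0 \<le> B" using D0 c by (simp add: B_def)
  \<comment> \<open>The step errors add up to \<open>h * (1 + real d * B) * e\<close>, which this
    choice makes at most \<open>\<epsilon> / 2\<close>; the \<open>+ 1\<close> keeps the denominator
    positive for \<open>h = 0\<close>.\<close>
  define e where "e = \<epsilon> / (2 * (h * (1 + real d * B) + 1))"
  have pos: "0 < h * (1 + real d * B) + 1" using h B0 by (intro add_nonneg_pos) auto
  then have e: "0 < e" using \<epsilon> by (simp add: e_def)
  obtain \<delta> where \<delta>: "0 < \<delta>" "\<And>s r v. v \<in> carrier_vec d \<Longrightarrow> 0 \<le> r \<Longrightarrow> 0 \<le> s - r \<Longrightarrow> s \<le> T \<Longrightarrow> r < \<delta> \<Longrightarrow>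
    r * vnorm (g v) < \<delta> \<Longrightarrow> vnorm v + r * vnorm (g v) \<le> R \<Longrightarrow>
    \<bar>w (s - r) (v + r \<cdot>\<^sub>v g v) - w s v\<bar> \<le> r * e * (1 + (\<Sum>i<d. \<bar>g v $ i\<bar>))"
    using characteristic_increment[OF e, of R] by blast
  \<comment> \<open>From \<open>M\<close> on, the step length \<open>k\<close> satisfies
    \<open>k * (1 + B) < \<delta>\<close>, which gives both \<open>k < \<delta>\<close> and
    \<open>k * B < \<delta>\<close>.\<close>
  obtain M :: nat where M: "h * (1 + B) / \<delta> < real M" using reals_Archimedean2 by blast
  have "norm (w (s - h) (euler g (h / real (Suc m)) (Suc m) y) - w s y) < \<epsilon>" if m: "M \<le> m" for m
  proof -
    define k where "k = h / real (Suc m)"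
    have k: "0 \<le> k" "k \<le> h" "real (Suc m) * k = h"
      using h by (auto simp: k_def field_simps)
    have "h * (1 + B) < real M * \<delta>" using M \<delta>(1) by (simp add: field_simps)
    also have "\<dots> \<le> real (Suc m) * \<delta>" using m \<delta>(1) by (intro mult_right_mono) auto
    finally have kB: "k * (1 + B) < \<delta>" by (simp add: k_def field_simps)
    define v where "v j = euler g k j y" for j
    have v: "v j \<in> carrier_vec d" for j using y by (simp add: v_def)
    have step: "\<bar>w (s - real (Suc j) * k) (v (Suc j)) - w (s - real j * k) (v j)\<bar> \<le> k * e * (1 + real d * B)"
      if j: "j < Suc m" for j
    proof -
      have jk: "real j * k \<le> h" "real (Suc j) * k \<le> h"
        using mult_right_mono[of "real j" "real (Suc m)" k] mult_right_mono[of "real (Suc j)" "real (Suc m)" k]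
          j k by auto
      have "real j * k * vnorm (g y) * exp (real j * k * c) \<le> D"
        unfolding D_def using jk k c by (intro mult_mono) auto
      then have disp: "vnorm (v j - y) \<le> D"
        using euler_displacement[OF y k(1), of j] by (simp add: v_def)
      have gv: "vnorm (g (v j)) \<le> B"
      proof -
        have "vnorm (g (v j)) \<le> vnorm (g y) + vnorm (g (v j) - g y)"
          using v y by (intro vnorm_le_diff[of _ d]) auto
        also have "\<dots> \<le> vnorm (g y) + c * vnorm (v j - y)" using g_lip[OF v y] by simp
        also have "\<dots> \<le> B" using disp c by (simp add: B_def)
        finally show ?thesis .
      qed
      have kg: "k * vnorm (g (v j)) \<le> k * B" using gv k by (simp add: mult_left_mono)
      have kB0: "0 \<le> k * B" using k B0 by simp
      have vR: "vnorm (v j) + k * vnorm (g (v j)) \<le> R"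
        using kg vnorm_le_diff[OF v y, of j] disp mult_right_mono[OF k(2) B0] by (simp add: R_def)
      have "0 \<le> real j * k" "real (Suc j) * k = real j * k + k" using k(1) by (simp_all add: algebra_simps)
      with jk h have jk0: "0 \<le> s - real j * k - k" "s - real j * k \<le> T" by linarith+
      have "\<bar>w (s - real j * k - k) (v j + k \<cdot>\<^sub>v g (v j)) - w (s - real j * k) (v j)\<bar> \<le>
          k * e * (1 + (\<Sum>i<d. \<bar>g (v j) $ i\<bar>))"
        using v k(1) jk0 kB kg kB0 vR by (intro \<delta>(2)) (simp_all add: algebra_simps)
      also have "\<dots> \<le> k * e * (1 + real d * B)"
      proof (intro mult_left_mono add_left_mono)
        have "(\<Sum>i<d. \<bar>g (v j) $ i\<bar>) \<le> (\<Sum>i<d. B)"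
        proof (rule sum_mono)
          fix i assume "i \<in> {..<d}"
          then have "\<bar>g (v j) $ i\<bar> \<le> vnorm (g (v j))"
            using carrier_vecD[OF g_carrier[OF v]] by (intro index_le_vnorm) simp
          with gv show "\<bar>g (v j) $ i\<bar> \<le> B" by linarith
        qed
        then show "(\<Sum>i<d. \<bar>g (v j) $ i\<bar>) \<le> real d * B" by simp
      qed (use k e in simp)
      finally show ?thesis by (simp add: v_def algebra_simps)
    qed
    have "w (s - h) (v (Suc m)) - w s y =
        (\<Sum>j<Suc m. w (s - real (Suc j) * k) (v (Suc j)) - w (s - real j * k) (v j))"
      using sum_lessThan_telescope[of "\<lambda>j. w (s - real j * k) (v j)" "Suc m"] k(3) by (simp add: v_def)
    also have "\<bar>\<dots>\<bar> \<le> (\<Sum>j<Suc m. k * e * (1 + real d * B))"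
      using step by (intro order_trans[OF sum_abs] sum_mono) auto
    also have "\<dots> = real (Suc m) * k * e * (1 + real d * B)" by simp
    also have "\<dots> = h * (1 + real d * B) * e" using k(3) by simp
    also have "\<dots> \<le> (h * (1 + real d * B) + 1) * e" using e by simp
    also have "\<dots> = \<epsilon> / 2" using pos by (simp add: e_def field_simps)
    finally show ?thesis using \<epsilon> by (simp add: v_def k_def)
  qed
  then show "\<exists>M. \<forall>m\<ge>M. norm (w (s - h) (euler g (h / real (Suc m)) (Suc m) y) - w s y) < \<epsilon>" by blast
qed

text \<open>Going back by the whole time \<open>t\<close> makes both values limits of
  \<open>w 0\<close> at Euler polygons, and \<open>w_init\<close> with
  \<open>euler_lipschitz\<close> bounds the differences uniformly along the limit.\<close>

lemma w_lipschitz: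
  assumes t: "0 \<le> t" "t \<le> T" and xy: "x \<in> carrier_vec d" "y \<in> carrier_vec d"
  shows "\<bar>w t x - w t y\<bar> \<le> c * exp (T * c) * vnorm (x - y)"
proof (rule LIMSEQ_le_const2)
  let ?e = "\<lambda>m. euler g (t / real (Suc m)) (Suc m)"
  show "(\<lambda>m. \<bar>w (t - t) (?e m x) - w (t - t) (?e m y)\<bar>) \<longlonglongrightarrow> \<bar>w t x - w t y\<bar>"
    using xy t by (intro tendsto_rabs tendsto_diff euler_tendsto) auto
  have "\<bar>w (t - t) (?e m x) - w (t - t) (?e m y)\<bar> \<le> c * exp (T * c) * vnorm (x - y)" for m
  proof -
    have "\<bar>w 0 (?e m x) - w 0 (?e m y)\<bar> \<le> c * vnorm (?e m x - ?e m y)"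
      using xy by (intro w_init euler_g_carrier)
    also have "\<dots> \<le> c * (exp (t * c) * vnorm (x - y))"
      using euler_lipschitz[OF xy, of "t / real (Suc m)" "Suc m"] t c
      by (intro mult_left_mono) (simp_all del: euler_Suc of_nat_Suc)
    also have "\<dots> \<le> c * (exp (T * c) * vnorm (x - y))"
      using t c by (intro mult_left_mono mult_right_mono) auto
    finally show ?thesis by (simp del: euler_Suc)
  qed
  then show "\<exists>N. \<forall>m\<ge>N. \<bar>w (t - t) (?e m x) - w (t - t) (?e m y)\<bar> \<le> c * exp (T * c) * vnorm (x - y)"
    by blast
qed

text \<open>Consistency of one Euler step. The refined polygons of the same total length have
  \<open>w\<close>-values tending to \<open>w s y\<close>, and by \<open>euler_refine\<close> their
  end points stay within order \<open>h\<^sup>2\<close> of the single step;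
  \<open>w_lipschitz\<close> transfers this to \<open>w\<close>.\<close>

lemma w_euler_step:
  assumes y: "y \<in> carrier_vec d" and h: "0 \<le> h" "h \<le> s" "s \<le> T"
  shows "\<bar>w s y - w (s - h) (y + h \<cdot>\<^sub>v g y)\<bar> \<le>
    c * exp (T * c) * (c * h\<^sup>2 * vnorm (g y) * exp (T * c))"
proof (rule LIMSEQ_le_const2)
  let ?e = "\<lambda>m. euler g (h / real (Suc m)) (Suc m) y" and ?z = "y + h \<cdot>\<^sub>v g y"
  show "(\<lambda>m. \<bar>w (s - h) (?e m) - w (s - h) ?z\<bar>) \<longlonglongrightarrow> \<bar>w s y - w (s - h) ?z\<bar>"
    using y h by (intro tendsto_rabs tendsto_diff euler_tendsto tendsto_const) auto
  have "\<bar>w (s - h) (?e m) - w (s - h) ?z\<bar> \<le>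
    c * exp (T * c) * (c * h\<^sup>2 * vnorm (g y) * exp (T * c))" for m
  proof -
    have z: "?z \<in> carrier_vec d" using y by simp
    have "\<bar>w (s - h) (?e m) - w (s - h) ?z\<bar> \<le> c * exp (T * c) * vnorm (?e m - ?z)"
      using z y h by (intro w_lipschitz euler_g_carrier) auto
    also have "\<dots> \<le> c * exp (T * c) * (c * h\<^sup>2 * vnorm (g y) * exp (T * c))"
    proof (rule mult_left_mono)
      have "vnorm (?e m - ?z) \<le> c * h\<^sup>2 * vnorm (g y) * exp (h * c)"
        using euler_refine[OF y, of "h / real (Suc m)" "Suc m"] h by (simp del: euler_Suc of_nat_Suc)
      also have "\<dots> \<le> c * h\<^sup>2 * vnorm (g y) * exp (T * c)"
        using h c by (intro mult_left_mono) auto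
      finally show "vnorm (?e m - ?z) \<le> c * h\<^sup>2 * vnorm (g y) * exp (T * c)" .
    qed (use c in simp)
    finally show ?thesis .
  qed
  then show "\<exists>N. \<forall>m\<ge>N. \<bar>w (s - h) (?e m) - w (s - h) ?z\<bar> \<le>
    c * exp (T * c) * (c * h\<^sup>2 * vnorm (g y) * exp (T * c))" by blast
qed

text \<open>Telescopes \<open>w\<close> along the polygon of \<open>\<phi>\<close>. Each defect
  splits at the end point of the Euler step for \<open>g\<close>: the consistency error of
  \<open>w_euler_step\<close>, then \<open>w_lipschitz\<close> applied to the difference of
  \<open>g\<close> and \<open>\<phi>\<close>. As \<open>w\<close> is evaluated at every node, the
  defects simply add, over a total time of at most \<open>T\<close>.\<close>

lemma w_perturbed_euler:
  assumes x: "x \<in> carrier_vec d" and \<phi>: "\<phi> \<in> carrier_vec d \<rightarrow> carrier_vec d"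
    and t: "0 \<le> t" "t \<le> T" and N: "0 < N"
    and M: "\<And>n. n < N \<Longrightarrow> vnorm (g (euler \<phi> (t / real N) n x)) \<le> M\<^sub>1"
      "\<And>n. n < N \<Longrightarrow> vnorm (g (euler \<phi> (t / real N) n x) - \<phi> (euler \<phi> (t / real N) n x)) \<le> M\<^sub>2"
  shows "\<bar>w t x - w 0 (euler \<phi> (t / real N) N x)\<bar> \<le>
    c * exp (T * c) * T * (c * (T / real N) * exp (T * c) * M\<^sub>1 + M\<^sub>2)"
proof -
  define h where "h = t / real N"
  have h: "0 \<le> h" "real N * h = t" using t N by (simp_all add: h_def)
  define y where "y n = euler \<phi> h n x" for n
  define L where "L = c * exp (T * c)"
  have L: "0 \<le> L" using c by (simp add: L_def)
  have y: "y n \<in> carrier_vec d" for n unfolding y_def by (rule euler_carrier[OF \<phi> x])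
  have step: "\<bar>w (t - real n * h) (y n) - w (t - real (Suc n) * h) (y (Suc n))\<bar> \<le>
      L * h * (c * h * exp (T * c) * M\<^sub>1 + M\<^sub>2)" if n: "n < N" for n
  proof -
    have nh: "real n * h \<le> t" "real (Suc n) * h \<le> t"
      using mult_right_mono[of "real n" "real N" h] mult_right_mono[of "real (Suc n)" "real N" h]
        n h by auto
    let ?s = "t - real n * h" and ?z = "y n + h \<cdot>\<^sub>v g (y n)"
    have phi: "\<phi> (y n) \<in> carrier_vec d" using \<phi> y by (rule funcset_mem)
    have s: "?s - h = t - real (Suc n) * h" by (simp add: algebra_simps)
    have hs: "h \<le> ?s" using nh(2) by (simp add: algebra_simps)
    have nh0: "0 \<le> real n * h" using h by simp
    have sT: "?s \<le> T" "?s - h \<le> T" using nh0 h(1) t by linarith+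
    have "\<bar>w ?s (y n) - w (?s - h) ?z\<bar> \<le> L * (c * h\<^sup>2 * vnorm (g (y n)) * exp (T * c))"
      unfolding L_def using y h(1) hs sT by (intro w_euler_step) auto
    also have "\<dots> \<le> L * (c * h\<^sup>2 * M\<^sub>1 * exp (T * c))"
      using M(1)[OF n] L c by (intro mult_left_mono mult_right_mono) (simp_all add: y_def h_def)
    finally have 1: "\<bar>w ?s (y n) - w (?s - h) ?z\<bar> \<le> L * (c * h\<^sup>2 * M\<^sub>1 * exp (T * c))" .
    have "?z - y (Suc n) = h \<cdot>\<^sub>v (g (y n) - \<phi> (y n))"
      using carrier_vecD[OF y, of n] carrier_vecD[OF phi] carrier_vecD[OF g_carrier[OF y], of n]
      by (intro eq_vecI) (simp_all add: y_def algebra_simps)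
    then have zy: "vnorm (?z - y (Suc n)) \<le> h * M\<^sub>2"
      using M(2)[OF n, folded h_def, folded y_def] h(1) by (simp add: vnorm_smult mult_left_mono)
    have "\<bar>w (?s - h) ?z - w (?s - h) (y (Suc n))\<bar> \<le> L * vnorm (?z - y (Suc n))"
      unfolding L_def using y h(1) hs sT by (intro w_lipschitz) auto
    also have "\<dots> \<le> L * (h * M\<^sub>2)" using zy L by (rule mult_left_mono)
    finally have "\<bar>w (?s - h) ?z - w (?s - h) (y (Suc n))\<bar> \<le> L * (h * M\<^sub>2)" .
    with 1 have "\<bar>w ?s (y n) - w (?s - h) (y (Suc n))\<bar> \<le>
        L * (c * h\<^sup>2 * M\<^sub>1 * exp (T * c)) + L * (h * M\<^sub>2)" by linarith
    then show ?thesis unfolding s by (simp add: algebra_simps power2_eq_square)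
  qed
  have M0: "0 \<le> M\<^sub>1" "0 \<le> M\<^sub>2"
    using order_trans[OF vnorm_nonneg M(1)[OF N]] order_trans[OF vnorm_nonneg M(2)[OF N]] by auto
  have "w 0 (y N) - w t x = (\<Sum>n<N. w (t - real (Suc n) * h) (y (Suc n)) - w (t - real n * h) (y n))"
    using sum_lessThan_telescope[of "\<lambda>n. w (t - real n * h) (y n)" N] h(2) by (simp add: y_def)
  also have "\<bar>\<dots>\<bar> \<le> (\<Sum>n<N. L * h * (c * h * exp (T * c) * M\<^sub>1 + M\<^sub>2))"
    using step by (intro order_trans[OF sum_abs] sum_mono) (auto simp: abs_minus_commute)
  also have "\<dots> = L * (real N * h) * (c * h * exp (T * c) * M\<^sub>1 + M\<^sub>2)" by simp
  also have "\<dots> \<le> L * T * (c * (T / real N) * exp (T * c) * M\<^sub>1 + M\<^sub>2)"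
  proof (rule mult_mono)
    show "L * (real N * h) \<le> L * T" using h(2) t L by (simp add: mult_left_mono)
    have "h \<le> T / real N" unfolding h_def using t N by (simp add: divide_right_mono)
    then show "c * h * exp (T * c) * M\<^sub>1 + M\<^sub>2 \<le> c * (T / real N) * exp (T * c) * M\<^sub>1 + M\<^sub>2"
      using c M0 by (intro add_right_mono mult_right_mono mult_left_mono) auto
  qed (use L T M0 c h in auto)
  finally show ?thesis by (simp add: L_def y_def h_def abs_minus_commute)
qed

end

section \<open>The error of the perturbed Euler scheme\<close>

text \<open>Converts the linear growth of polygons into the weight
  \<open>1 + X powr \<kappa>\<close> of the approximation spaces.\<close>

lemma one_plus_powr_le:
  assumes "0 \<le> (X::real)" "1 \<le> \<kappa>"
  shows "(1 + X) powr \<kappa> \<le> 2 powr \<kappa> * (1 + X powr \<kappa>)" "X \<le> 1 + X powr \<kappa>"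
proof -
  show "(1 + X) powr \<kappa> \<le> 2 powr \<kappa> * (1 + X powr \<kappa>)"
  proof (cases "X \<le> 1")
    case True
    have "(1 + X) powr \<kappa> \<le> 2 powr \<kappa> * 1" using True assms by (simp add: powr_mono2)
    also have "\<dots> \<le> 2 powr \<kappa> * (1 + X powr \<kappa>)" by (intro mult_left_mono) auto
    finally show ?thesis .
  next
    case False
    have "(1 + X) powr \<kappa> \<le> (2 * X) powr \<kappa>" using False assms by (intro powr_mono2) auto
    also have "\<dots> = 2 powr \<kappa> * X powr \<kappa>" using False by (simp add: powr_mult)
    also have "\<dots> \<le> 2 powr \<kappa> * (1 + X powr \<kappa>)" by (intro mult_left_mono) auto
    finally show ?thesis .
  qed
  show "X \<le> 1 + X powr \<kappa>"
  proof (cases "X \<le> 1")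
    case True
    then show ?thesis using powr_ge_zero[of X \<kappa>] by linarith
  next
    case False
    then have "X powr 1 \<le> X powr \<kappa>" using assms by (intro powr_mono) auto
    then show ?thesis using False by simp
  qed
qed

text \<open>In the application \<open>S\<close> is a power of \<open>1 / \<eta>\<close> times a
  power of \<open>d\<close>, and \<open>b\<close> is a power of \<open>d\<close>. The growth bound
  of \<open>\<phi>\<close> confines the polygon to norm \<open>A * S * (1 + vnorm x)\<close>, with
  \<open>A\<close> free of \<open>S\<close>. Hence the consistency error is linear in
  \<open>S\<close>, while the approximation errors carry
  \<open>\<eta> * S powr \<kappa>\<close>.\<close>

lemma (in transport) network_error:
  fixes S :: real
  assumes x: "x \<in> carrier_vec d" and \<phi>: "\<phi> \<in> carrier_vec d \<rightarrow> carrier_vec d"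
    and t: "0 \<le> t" "t \<le> T" and N: "0 < N" and \<kappa>: "1 \<le> \<kappa>" and K: "0 \<le> K" and S: "1 \<le> S" and b: "1 \<le> b"
    and \<eta>: "0 \<le> \<eta>" and g0: "vnorm (g (0\<^sub>v d)) \<le> c * b"
    and \<phi>_approx: "\<And>y. y \<in> carrier_vec d \<Longrightarrow> vnorm (g y - \<phi> y) \<le> \<eta> * (1 + vnorm y powr \<kappa>)"
    and \<phi>_growth: "\<And>y. y \<in> carrier_vec d \<Longrightarrow> vnorm (\<phi> y) \<le> K * (S + vnorm y)"
    and \<psi>_approx: "\<And>y. y \<in> carrier_vec d \<Longrightarrow> \<bar>w 0 y - \<psi> y\<bar> \<le> \<eta> * (1 + vnorm y powr \<kappa>)"
  defines "A \<equiv> exp (T * K) * (1 + T * K)"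
  shows "\<bar>w t x - \<psi> (euler \<phi> (t / real N) N x)\<bar> \<le>
    (c * exp (T * c) * T * (c * T * exp (T * c) * (4 * c * A)) * b * S / real N +
     (c * exp (T * c) * T + 1) * (2 * (2 * A) powr \<kappa>) * (\<eta> * S powr \<kappa>)) * (1 + vnorm x powr \<kappa>)"
proof -
  define X where "X = vnorm x"
  define Z where "Z = 1 + X powr \<kappa>"
  define V where "V = (2 * A) powr \<kappa>"
  define h where "h = t / real N"
  define y where "y n = euler \<phi> h n x" for n
  define M1 where "M1 = 4 * c * A * b * S * Z"
  define M2 where "M2 = \<eta> * (2 * V * S powr \<kappa> * Z)"
  have X: "0 \<le> X" by (simp add: X_def)
  have Z: "1 \<le> Z" by (simp add: Z_def)
  have TK: "0 \<le> T * K" using T K by simp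
  have "1 * 1 \<le> exp (T * K) * (1 + T * K)" using TK by (intro mult_mono) auto
  then have A: "1 \<le> A" by (simp add: A_def)
  have y: "y n \<in> carrier_vec d" for n unfolding y_def by (rule euler_carrier[OF \<phi> x])
  have y_le: "vnorm (y n) \<le> A * S * (1 + X)" if n: "n \<le> N" for n
  proof -
    have h: "0 \<le> h" "real N * h = t" using t N by (simp_all add: h_def)
    have nh: "real n * h \<le> T" "0 \<le> real n * h"
      using mult_right_mono[of "real n" "real N" h] n h t by auto
    have "vnorm (y n) \<le> exp (real n * h * K) * (vnorm x + real n * h * (K * S))"
      unfolding y_def using K S h \<phi>_growth
      by (intro vnorm_euler_le[OF \<phi> x]) (auto simp: algebra_simps)
    also have "\<dots> \<le> exp (T * K) * (X + T * (K * S))"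
      using nh K S X by (intro mult_mono add_mono) (auto simp: X_def mult_right_mono)
    also have "\<dots> \<le> exp (T * K) * ((1 + T * K) * S * (1 + X))"
    proof (rule mult_left_mono)
      have "X \<le> S * X" using mult_right_mono[OF S X] by simp
      moreover have "0 \<le> S + T * K * S * X" using S TK X by simp
      ultimately show "X + T * (K * S) \<le> (1 + T * K) * S * (1 + X)" by (simp add: algebra_simps)
    qed simp
    finally show ?thesis by (simp add: A_def mult_ac)
  qed
  have Zy: "1 + vnorm (y n) powr \<kappa> \<le> 2 * V * S powr \<kappa> * Z" if n: "n \<le> N" for n
  proof -
    have "vnorm (y n) powr \<kappa> \<le> (A * S * (1 + X)) powr \<kappa>"
      using y_le[OF n] \<kappa> by (intro powr_mono2) auto
    also have "\<dots> = A powr \<kappa> * S powr \<kappa> * (1 + X) powr \<kappa>"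
      using A S X by (simp add: powr_mult)
    also have "\<dots> \<le> A powr \<kappa> * S powr \<kappa> * (2 powr \<kappa> * Z)"
      unfolding Z_def using one_plus_powr_le(1)[OF X \<kappa>] by (intro mult_left_mono) auto
    also have "\<dots> = V * S powr \<kappa> * Z" using A by (simp add: V_def powr_mult mult_ac)
    finally have 1: "vnorm (y n) powr \<kappa> \<le> V * S powr \<kappa> * Z" .
    have "1 * 1 * 1 \<le> V * S powr \<kappa> * Z"
      unfolding V_def using A S Z \<kappa> by (intro mult_mono ge_one_powr_ge_zero) auto
    with 1 show ?thesis by simp
  qed
  have M1: "vnorm (g (y n)) \<le> M1" if n: "n < N" for n
  proof -
    have "vnorm (g (y n)) \<le> vnorm (g (0\<^sub>v d)) + vnorm (g (y n) - g (0\<^sub>v d))"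
      using y by (intro vnorm_le_diff[of _ d]) auto
    also have "\<dots> \<le> c * b + c * vnorm (y n - 0\<^sub>v d)"
      using g0 g_lip[OF y[of n] zero_carrier_vec] by (intro add_mono) auto
    also have "y n - 0\<^sub>v d = y n" using y[of n] by simp
    also have "c * b + c * vnorm (y n) \<le> c * (b * (A * S * (1 + X))) + c * (b * (A * S * (1 + X)))"
    proof (intro add_mono mult_left_mono)
      have AS: "1 * 1 * 1 \<le> A * S * (1 + X)" using A S X by (intro mult_mono) auto
      from mult_left_mono[OF this, of b] show "b \<le> b * (A * S * (1 + X))" using b by simp
      from mult_right_mono[OF b, of "A * S * (1 + X)"] AS y_le[of n] n
      show "vnorm (y n) \<le> b * (A * S * (1 + X))" by simp
    qed (use c in auto)
    also have "\<dots> = 2 * c * A * b * S * (1 + X)" by simp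
    also have "\<dots> \<le> 2 * c * A * b * S * (2 * Z)"
    proof (rule mult_left_mono)
      show "1 + X \<le> 2 * Z"
        using add_mono[OF Z one_plus_powr_le(2)[OF X \<kappa>]] by (simp add: Z_def)
    qed (use c A b S in simp)
    finally show ?thesis by (simp add: M1_def)
  qed
  have M2: "\<eta> * (1 + vnorm (y n) powr \<kappa>) \<le> M2" if n: "n \<le> N" for n
    unfolding M2_def using Zy[OF n] \<eta> by (rule mult_left_mono)
  have "\<bar>w t x - w 0 (y N)\<bar> \<le> c * exp (T * c) * T * (c * (T / real N) * exp (T * c) * M1 + M2)"
    unfolding y_def h_def
  proof (rule w_perturbed_euler[OF x \<phi> t N])
    fix n assume n: "n < N"
    show "vnorm (g (euler \<phi> (t / real N) n x)) \<le> M1" using M1[OF n] by (simp add: y_def h_def)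
    show "vnorm (g (euler \<phi> (t / real N) n x) - \<phi> (euler \<phi> (t / real N) n x)) \<le> M2"
      using order_trans[OF \<phi>_approx[OF y] M2[of n]] n by (simp add: y_def h_def)
  qed
  moreover have "\<bar>w 0 (y N) - \<psi> (y N)\<bar> \<le> M2"
    using order_trans[OF \<psi>_approx[OF y] M2[of N]] by simp
  ultimately have "\<bar>w t x - \<psi> (y N)\<bar> \<le>
      c * exp (T * c) * T * (c * (T / real N) * exp (T * c) * M1 + M2) + M2" by linarith
  also have "\<dots> = (c * exp (T * c) * T * (c * T * exp (T * c) * (4 * c * A)) * b * S / real N +
     (c * exp (T * c) * T + 1) * (2 * V) * (\<eta> * S powr \<kappa>)) * Z"
    unfolding M1_def M2_def by (simp add: algebra_simps)
  finally show ?thesis by (simp add: y_def h_def V_def Z_def X_def)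
qed

section \<open>Choice of the accuracy and of the number of Euler steps\<close>

text \<open>The second error term contains \<open>\<eta>\<close> to the positive power
  \<open>1 - \<delta> * \<kappa>\<close>, so it fixes \<open>\<eta>\<close> first; then
  \<open>N\<close> is taken large enough for the first term. Both \<open>1 / \<eta>\<close> and
  \<open>N\<close> stay polynomial in \<open>d / \<epsilon>\<close>, and so does the network
  size.\<close>

lemma parameter_choice:
  fixes C1 C2 c K \<kappa> \<delta> :: real
  assumes C: "0 \<le> C1" "1 \<le> C2" and c: "0 < c" and K: "1 \<le> K" and \<kappa>: "1 \<le> \<kappa>"
    and \<delta>: "0 < \<delta>" "\<delta> < 1 / \<kappa>"
  shows "\<exists>K'\<ge>1. \<forall>d\<ge>1::nat. \<forall>\<epsilon>\<in>{0<..1}. \<exists>\<eta>\<in>{0<..1}. \<exists>N\<ge>1::nat.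
    C1 * real d powr c * (\<eta> powr (- \<delta>) * real d powr K) / real N +
      C2 * (\<eta> * (\<eta> powr (- \<delta>) * real d powr K) powr \<kappa>) \<le> \<epsilon> \<and>
    (\<forall>p r q. real p \<le> K * (real d / \<eta>) powr K \<longrightarrow> real r \<le> K * (real d / \<eta>) powr K \<longrightarrow>
      q \<le> 2 * (d * (d + 1)) + N * (2 * ((2 * d + 1) ^ 3 * p)) + (2 * d + 1) * r \<longrightarrow>
      real q \<le> K' * (real d / \<epsilon>) powr K')"
proof -
  \<comment> \<open>With \<open>Q = d / \<epsilon>\<close>, the choice \<open>\<eta>\<^sup>\<rho> = 1 / (2 * C2 * Q powr (K * \<kappa> + 1))\<close> makes the second error
    term at most \<open>\<epsilon> / 2\<close>, and then \<open>1 / \<eta> = E * Q powr b\<close>.\<close>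
  define \<rho> where "\<rho> = 1 - \<delta> * \<kappa>"
  have \<rho>: "0 < \<rho>" using \<delta> \<kappa> by (simp add: \<rho>_def field_simps)
  have \<delta>1: "\<delta> \<le> 1" using \<delta> \<kappa> by (smt (verit) divide_le_eq_1)
  define b where "b = (K * \<kappa> + 1) / \<rho>"
  have b: "0 \<le> b" using K \<kappa> \<rho> by (simp add: b_def)
  define E where "E = (2 * C2) powr (1 / \<rho>)"
  have E: "1 \<le> E" using C \<rho> by (simp add: E_def ge_one_powr_ge_zero)
  \<comment> \<open>Exponents of \<open>Q\<close>: \<open>a1\<close> for \<open>N\<close>, from
    \<open>D powr c\<close>, \<open>S\<close> and \<open>1 / \<epsilon>\<close>; \<open>a2\<close>
    for the sizes of the two given networks; the \<open>3\<close> in \<open>a\<close> for the cube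
    of \<open>2 * d + 1\<close>.\<close>
  define a1 where "a1 = c + b + K + 1"
  define a2 where "a2 = (b + 1) * K"
  define a where "a = a1 + 3 + a2"
  have a12: "2 \<le> a1" "0 \<le> a2" using b c K by (simp_all add: a1_def a2_def)
  define P where "P = K * E powr K"
  have P: "0 \<le> P" using K by (simp add: P_def)
  \<comment> \<open>The coefficients of the three summands of the size bound, with
    \<open>54 = 2 * 3 ^ 3\<close>.\<close>
  define J where "J = 4 + (2 * C1 * E + 2) * (54 * P) + 3 * P"
  define K' where "K' = max J a"
  have J: "0 \<le> J" using C E P by (simp add: J_def)
  have K'1: "1 \<le> K'" using a12 by (simp add: K'_def a_def)
  have main: "\<exists>\<eta>\<in>{0<..1}. \<exists>N\<ge>1::nat.
    C1 * real d powr c * (\<eta> powr (- \<delta>) * real d powr K) / real N +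
      C2 * (\<eta> * (\<eta> powr (- \<delta>) * real d powr K) powr \<kappa>) \<le> \<epsilon> \<and>
    (\<forall>p r q. real p \<le> K * (real d / \<eta>) powr K \<longrightarrow> real r \<le> K * (real d / \<eta>) powr K \<longrightarrow>
      q \<le> 2 * (d * (d + 1)) + N * (2 * ((2 * d + 1) ^ 3 * p)) + (2 * d + 1) * r \<longrightarrow>
      real q \<le> K' * (real d / \<epsilon>) powr K')"
    if d: "1 \<le> d" and \<epsilon>: "0 < \<epsilon>" "\<epsilon> \<le> 1" for d :: nat and \<epsilon> :: real
  proof -
    define D where "D = real d"
    define Q where "Q = D / \<epsilon>"
    have D: "1 \<le> D" using d by (simp add: D_def)
    have DQ: "D \<le> Q" using D \<epsilon> by (simp add: Q_def field_simps)
    have \<epsilon>Q: "1 / \<epsilon> \<le> Q" using D \<epsilon> by (simp add: Q_def divide_right_mono)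
    have Q: "1 \<le> Q" using D DQ by simp
    define B where "B = 2 * C2 * Q powr (K * \<kappa> + 1)"
    have "1 \<le> Q powr (K * \<kappa> + 1)" using Q K \<kappa> by (intro ge_one_powr_ge_zero) auto
    then have B: "1 \<le> B" using C mult_mono[of 1 "2 * C2" 1 "Q powr (K * \<kappa> + 1)"] by (simp add: B_def)
    define \<eta> where "\<eta> = B powr (- (1 / \<rho>))"
    have \<eta>0: "0 < \<eta>" using B by (simp add: \<eta>_def)
    have "\<eta> \<le> B powr 0" unfolding \<eta>_def using B \<rho> by (intro powr_mono) auto
    then have \<eta>1: "\<eta> \<le> 1" using B by simp
    have \<eta>inv: "1 / \<eta> = E * Q powr b"
    proof -
      have "1 / \<eta> = B powr (1 / \<rho>)" by (simp add: \<eta>_def powr_minus_divide)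
      also have "\<dots> = E * (Q powr (K * \<kappa> + 1)) powr (1 / \<rho>)"
        unfolding B_def E_def using C by (subst powr_mult) auto
      also have "\<dots> = E * Q powr b" by (simp add: powr_powr b_def)
      finally show ?thesis .
    qed
    define S where "S = \<eta> powr (- \<delta>) * D powr K"
    have S0: "0 < S" using \<eta>0 D by (simp add: S_def)
    have \<eta>S: "C2 * (\<eta> * S powr \<kappa>) \<le> \<epsilon> / 2"
    proof -
      have S: "S powr \<kappa> = \<eta> powr (- \<delta> * \<kappa>) * D powr (K * \<kappa>)"
        unfolding S_def by (subst powr_mult) (simp_all add: powr_powr)
      have "\<eta> powr \<rho> = B powr (- 1)" unfolding \<eta>_def powr_powr using \<rho> by simp
      then have "\<eta> powr \<rho> = 1 / B" using B by (simp add: powr_minus_divide)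
      moreover have "\<eta> * \<eta> powr (- \<delta> * \<kappa>) = \<eta> powr \<rho>"
        using \<eta>0 powr_add[of \<eta> 1 "- \<delta> * \<kappa>"] by (simp add: \<rho>_def)
      ultimately have \<eta>B: "\<eta> * \<eta> powr (- \<delta> * \<kappa>) = 1 / B" by simp
      have "C2 * (\<eta> * S powr \<kappa>) = C2 * D powr (K * \<kappa>) * (\<eta> * \<eta> powr (- \<delta> * \<kappa>))"
        unfolding S by (simp only: mult_ac)
      also have "\<dots> = D powr (K * \<kappa>) * (C2 / B)" unfolding \<eta>B by simp
      also have "C2 / B = 1 / (2 * Q powr (K * \<kappa> + 1))" using C by (simp add: B_def)
      also have "D powr (K * \<kappa>) * (1 / (2 * Q powr (K * \<kappa> + 1))) \<le>
          Q powr (K * \<kappa>) * (1 / (2 * Q powr (K * \<kappa> + 1)))"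
        using D DQ K \<kappa> by (intro mult_right_mono powr_mono2) auto
      also have "\<dots> = 1 / (2 * Q)" using Q by (simp add: powr_add)
      also have "\<dots> \<le> \<epsilon> / 2" using \<epsilon>Q \<epsilon> Q by (simp add: field_simps)
      finally show ?thesis .
    qed
    have S_le: "S \<le> E * Q powr (b + K)"
    proof -
      have "\<eta> powr (- \<delta>) = (1 / \<eta>) powr \<delta>" using \<eta>0 by (simp add: powr_minus_divide powr_divide)
      also have "\<dots> \<le> (1 / \<eta>) powr 1" using \<eta>0 \<eta>1 \<delta>1 by (intro powr_mono) auto
      also have "\<dots> = E * Q powr b" using \<eta>inv \<eta>0 E by simp
      finally have "\<eta> powr (- \<delta>) \<le> E * Q powr b" .
      then have "S \<le> (E * Q powr b) * Q powr K"
        unfolding S_def using D DQ K E by (intro mult_mono powr_mono2) auto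
      then show ?thesis by (simp add: powr_add mult_ac)
    qed
    \<comment> \<open>At least \<open>R\<close> steps bring the first error term down to
      \<open>\<epsilon> / 2\<close>; the \<open>Suc\<close> in \<open>N\<close> keeps it positive
      when \<open>R = 0\<close>.\<close>
    define R where "R = 2 * C1 * D powr c * S / \<epsilon>"
    have R: "0 \<le> R" using C S0 \<epsilon> by (simp add: R_def)
    define N where "N = Suc (nat \<lceil>R\<rceil>)"
    have N_ge: "R \<le> real N" unfolding N_def by linarith
    have N_le: "real N \<le> R + 2" unfolding N_def using R by linarith
    have N0: "0 < real N" by (simp add: N_def)
    have euler: "C1 * D powr c * S / real N \<le> \<epsilon> / 2"
    proof -
      have "2 * (C1 * D powr c * S) \<le> real N * \<epsilon>" using N_ge \<epsilon> by (simp add: R_def field_simps)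
      then show ?thesis using N0 by (simp add: field_simps)
    qed
    have Qa: "1 \<le> Q powr s" if "0 \<le> s" for s using Q that by (rule ge_one_powr_ge_zero)
    have N_bound: "real N \<le> (2 * C1 * E + 2) * Q powr a1"
    proof -
      have "R = 2 * C1 * (D powr c * S * (1 / \<epsilon>))" by (simp add: R_def)
      also have "\<dots> \<le> 2 * C1 * (Q powr c * (E * Q powr (b + K)) * Q)"
        using C S_le S0 \<epsilon>Q D DQ c \<epsilon> E by (intro mult_left_mono mult_mono powr_mono2) auto
      also have "\<dots> = 2 * C1 * E * Q powr a1" using Q by (simp add: a1_def powr_add)
      finally have "R \<le> 2 * C1 * E * Q powr a1" .
      then show ?thesis using N_le Qa[of a1] a12 by (simp add: algebra_simps)
    qed
    have size: "real q \<le> K' * Q powr K'"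
      if p: "real p \<le> K * (real d / \<eta>) powr K" and r: "real r \<le> K * (real d / \<eta>) powr K"
        and q: "q \<le> 2 * (d * (d + 1)) + N * (2 * ((2 * d + 1) ^ 3 * p)) + (2 * d + 1) * r" for p r q :: nat
    proof -
      have pr: "K * (real d / \<eta>) powr K \<le> P * Q powr a2"
      proof -
        have "real d / \<eta> = D * (E * Q powr b)" using \<eta>inv by (simp add: D_def divide_inverse)
        also have "\<dots> \<le> Q * (E * Q powr b)" using DQ E by (intro mult_right_mono) auto
        also have "\<dots> = E * Q powr (b + 1)" using Q by (simp add: powr_add)
        finally have "(real d / \<eta>) powr K \<le> (E * Q powr (b + 1)) powr K"
          using K \<eta>0 by (intro powr_mono2) auto
        also have "\<dots> = E powr K * Q powr a2"
          using E by (simp add: powr_mult powr_powr a2_def)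
        finally show ?thesis using K by (simp add: P_def mult.assoc mult_left_mono)
      qed
      have d1: "real (2 * d + 1) \<le> 3 * Q" using DQ D by (simp add: D_def)
      have Qp: "Q ^ 3 = Q powr 3" "Q = Q powr 1" using Q powr_numeral[of Q "num.Bit1 num.One"] by auto
      have "real q \<le> real (2 * (d * (d + 1)) + N * (2 * ((2 * d + 1) ^ 3 * p)) + (2 * d + 1) * r)"
        using q by (rule of_nat_mono)
      also have "\<dots> = 2 * (D * (D + 1)) + real N * (2 * (real (2 * d + 1) ^ 3 * real p)) + real (2 * d + 1) * real r"
        by (simp only: D_def of_nat_add of_nat_mult of_nat_power of_nat_numeral of_nat_1)
      also have "\<dots> \<le> 2 * (Q * (2 * Q)) +
          ((2 * C1 * E + 2) * Q powr a1) * (2 * ((3 * Q) ^ 3 * (P * Q powr a2))) + (3 * Q) * (P * Q powr a2)"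
        using D DQ Q N_bound d1 p r pr P C E
        by (intro add_mono mult_left_mono mult_mono power_mono) auto
      also have "\<dots> = 4 * Q powr 2 + ((2 * C1 * E + 2) * (54 * P)) * (Q powr a1 * Q ^ 3 * Q powr a2) + 3 * P * (Q * Q powr a2)"
        using Q by (simp add: power_mult_distrib power2_eq_square)
      also have "Q powr a1 * Q ^ 3 * Q powr a2 = Q powr a"
        unfolding Qp(1) a_def by (simp add: powr_add)
      also have "Q * Q powr a2 = Q powr (1 + a2)"
        using Q by (simp add: powr_add)
      also have "4 * Q powr 2 + ((2 * C1 * E + 2) * (54 * P)) * Q powr a + 3 * P * Q powr (1 + a2) \<le>
          4 * Q powr a + ((2 * C1 * E + 2) * (54 * P)) * Q powr a + 3 * P * Q powr a"
        using Q P C E a12 by (intro add_mono mult_left_mono powr_mono) (auto simp: a_def)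
      also have "\<dots> = J * Q powr a" by (simp add: J_def algebra_simps)
      also have "\<dots> \<le> K' * Q powr K'"
        using J Q by (intro mult_mono powr_mono) (auto simp: K'_def)
      finally show ?thesis .
    qed
    have total: "C1 * D powr c * S / real N + C2 * (\<eta> * S powr \<kappa>) \<le> \<epsilon>"
      using euler \<eta>S by linarith
    show ?thesis
    proof (intro bexI[of _ \<eta>] exI[of _ N] conjI allI impI)
      show "C1 * real d powr c * (\<eta> powr (- \<delta>) * real d powr K) / real N +
        C2 * (\<eta> * (\<eta> powr (- \<delta>) * real d powr K) powr \<kappa>) \<le> \<epsilon>"
        using total unfolding S_def D_def .
    qed (use size \<eta>0 \<eta>1 in \<open>simp_all add: Q_def D_def N_def\<close>)
  qed
  show ?thesis using main K'1 by (intro exI[of _ K']) simp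
qed

section \<open>The approximation spaces\<close>

text \<open>The two powers combine to \<open>(d / \<epsilon>) powr K\<close>, whose base is at least
  \<open>1\<close>. Since \<open>K\<close> may be negative, it is enlarged to a nonnegative
  \<open>L\<close>.\<close>

lemma poly_rate_mono:
  fixes K L d \<epsilon> :: real
  assumes "K \<le> L" "0 \<le> L" "1 \<le> d" "0 < \<epsilon>" "\<epsilon> \<le> 1"
  shows "K * \<epsilon> powr (- K) * d powr K \<le> L * (d / \<epsilon>) powr L"
proof -
  have q: "1 \<le> d / \<epsilon>" using assms by (simp add: field_simps)
  have "K * \<epsilon> powr (- K) * d powr K = K * (d / \<epsilon>) powr K"
    using assms by (simp add: powr_minus_divide powr_divide mult_ac)
  also have "\<dots> \<le> L * (d / \<epsilon>) powr K" using assms by (intro mult_right_mono) auto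
  also have "\<dots> \<le> L * (d / \<epsilon>) powr L" using assms q by (intro mult_left_mono powr_mono) auto
  finally show ?thesis .
qed

text \<open>Stated for every sufficiently large \<open>L\<close>, so that a common constant can
  serve both the vector fields and the initial values.\<close>

lemma approx_space_net:
  assumes h: "h \<in> approx_space \<kappa> \<delta>" and \<kappa>: "\<kappa> \<noteq> 0" and dims: "\<forall>d\<ge>1. h d \<in> Cont d (l d)"
  shows "\<exists>K. \<forall>L\<ge>K. \<forall>d\<ge>1. \<forall>\<epsilon>\<in>{0<..1}. \<exists>p \<phi>. net d (l d) p \<phi> \<and>
    real p \<le> L * (real d / \<epsilon>) powr L \<and>
    (\<forall>x\<in>carrier_vec d. vnorm (h d x - \<phi> x) \<le> \<epsilon> * (1 + vnorm x powr \<kappa>) \<and>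
       \<delta> * vnorm (\<phi> x) \<le> L * (\<epsilon> powr (- \<delta>) * real d powr L + vnorm x))"
proof -
  obtain K :: real where K: "\<forall>d\<ge>1. \<forall>\<epsilon>\<in>{0<..1}. \<exists>\<Phi>\<in>ANN. \<exists>dd\<ge>1. \<forall>x\<in>carrier_vec d.
        in_dim \<Phi> = d \<and> {h d, realization \<Phi>} \<subseteq> Cont d dd \<and>
        real (num_params \<Phi>) \<le> K * \<epsilon> powr (- K) * real d powr K \<and>
        vnorm (h d x - realization \<Phi> x)
          \<le> \<epsilon> * (1 + (if \<kappa> = 0 then 1 else vnorm x powr \<kappa>)) \<and>
        \<delta> * vnorm (realization \<Phi> x)
          \<le> K * (\<epsilon> powr (- \<delta>) * real d powr K + vnorm x)"
    using h unfolding approx_space_def by blast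
  have "\<exists>p \<phi>. net d (l d) p \<phi> \<and> real p \<le> L * (real d / \<epsilon>) powr L \<and>
    (\<forall>x\<in>carrier_vec d. vnorm (h d x - \<phi> x) \<le> \<epsilon> * (1 + vnorm x powr \<kappa>) \<and>
       \<delta> * vnorm (\<phi> x) \<le> L * (\<epsilon> powr (- \<delta>) * real d powr L + vnorm x))"
    if L: "max 0 K \<le> L" and d: "1 \<le> d" and \<epsilon>: "\<epsilon> \<in> {0<..1}" for L d \<epsilon>
  proof -
    obtain \<Phi> dd where \<Phi>: "\<Phi> \<in> ANN" and *: "\<forall>x\<in>carrier_vec d.
        in_dim \<Phi> = d \<and> {h d, realization \<Phi>} \<subseteq> Cont d dd \<and>
        real (num_params \<Phi>) \<le> K * \<epsilon> powr (- K) * real d powr K \<and>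
        vnorm (h d x - realization \<Phi> x)
          \<le> \<epsilon> * (1 + (if \<kappa> = 0 then 1 else vnorm x powr \<kappa>)) \<and>
        \<delta> * vnorm (realization \<Phi> x)
          \<le> K * (\<epsilon> powr (- \<delta>) * real d powr K + vnorm x)"
      using K[rule_format, OF d \<epsilon>] by (elim bexE exE conjE)
    \<comment> \<open>The conjuncts independent of \<open>x\<close> stand under the quantifier over
      \<open>x\<close>; the zero vector extracts them.\<close>
    have dim: "in_dim \<Phi> = d" and C: "h d \<in> Cont d dd" "realization \<Phi> \<in> Cont d dd"
      and np: "real (num_params \<Phi>) \<le> K * \<epsilon> powr (- K) * real d powr K"
      using bspec[OF * zero_carrier_vec[of d]] by simp_all
    obtain l' where net: "net d l' (num_params \<Phi>) (realization \<Phi>)"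
      using ANN_imp_net[OF \<Phi>] dim by metis
    have "l' = l d"
      using Cont_unique_dim[OF net_Cont[OF net] C(2)] Cont_unique_dim[OF C(1) dims[rule_format, OF d]] by simp
    moreover have "real (num_params \<Phi>) \<le> L * (real d / \<epsilon>) powr L"
      using np poly_rate_mono[of K L "real d" \<epsilon>] L d \<epsilon> by simp
    moreover have "\<delta> * vnorm (realization \<Phi> x) \<le> L * (\<epsilon> powr (- \<delta>) * real d powr L + vnorm x)"
      if x: "x \<in> carrier_vec d" for x
    proof -
      have "\<delta> * vnorm (realization \<Phi> x) \<le> K * (\<epsilon> powr (- \<delta>) * real d powr K + vnorm x)"
        using bspec[OF * x] by simp
      also have "\<dots> \<le> L * (\<epsilon> powr (- \<delta>) * real d powr K + vnorm x)"
        using L by (intro mult_right_mono) auto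
      also have "\<dots> \<le> L * (\<epsilon> powr (- \<delta>) * real d powr L + vnorm x)"
        using L d by (intro mult_left_mono add_right_mono powr_mono) auto
      finally show ?thesis .
    qed
    moreover have "vnorm (h d x - realization \<Phi> x) \<le> \<epsilon> * (1 + vnorm x powr \<kappa>)"
      if x: "x \<in> carrier_vec d" for x using bspec[OF * x] \<kappa> by simp
    ultimately show ?thesis using net by (intro exI[of _ "num_params \<Phi>"] exI[of _ "realization \<Phi>"]) simp
  qed
  then show ?thesis by (intro exI[of _ "max 0 K"]) blast
qed

text \<open>With the second index \<open>0\<close> the growth clause reduces to nonnegativity of its
  right-hand side, which \<open>0 \<le> K\<close> supplies.\<close>

lemma approx_spaceI:
  assumes \<kappa>: "\<kappa> \<noteq> 0" and l: "1 \<le> l" and K: "0 \<le> K" and C: "\<And>d. 1 \<le> d \<Longrightarrow> h d \<in> Cont d l"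
    and approx: "\<And>d \<epsilon>. 1 \<le> d \<Longrightarrow> \<epsilon> \<in> {0<..1} \<Longrightarrow> \<exists>p G. net d l p G \<and> real p \<le> K * (real d / \<epsilon>) powr K \<and>
      (\<forall>x\<in>carrier_vec d. vnorm (h d x - G x) \<le> \<epsilon> * (1 + vnorm x powr \<kappa>))"
  shows "h \<in> approx_space \<kappa> 0"
  unfolding approx_space_def mem_Collect_eq
proof (intro conjI allI impI exI[of _ K] ballI)
  fix d :: nat assume "1 \<le> d"
  then show "h d \<in> (\<Union>k\<in>{1..}. \<Union>l\<in>{1..}. Cont k l)" using l C by (intro UN_I[of d] UN_I[of l]) auto
next
  fix d :: nat and \<epsilon> :: real assume d: "1 \<le> d" and \<epsilon>: "\<epsilon> \<in> {0<..1}"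
  obtain p G where G: "net d l p G" "real p \<le> K * (real d / \<epsilon>) powr K"
    "\<forall>x\<in>carrier_vec d. vnorm (h d x - G x) \<le> \<epsilon> * (1 + vnorm x powr \<kappa>)"
    using approx[OF d \<epsilon>] by (elim exE conjE)
  obtain \<Phi> where \<Phi>: "\<Phi> \<in> ANN" "in_dim \<Phi> = d" "num_params \<Phi> = p" "realization \<Phi> = G"
    using net_imp_ANN[OF G(1)] .
  have "real p \<le> K * \<epsilon> powr (- K) * real d powr K"
    using G(2) \<epsilon> d by (simp add: powr_minus_divide powr_divide mult_ac)
  then show "\<exists>\<Phi>\<in>ANN. \<exists>dd\<ge>1. \<forall>x\<in>carrier_vec d.
        in_dim \<Phi> = d \<and> {h d, realization \<Phi>} \<subseteq> Cont d dd \<and>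
        real (num_params \<Phi>) \<le> K * \<epsilon> powr (- K) * real d powr K \<and>
        vnorm (h d x - realization \<Phi> x)
          \<le> \<epsilon> * (1 + (if \<kappa> = 0 then 1 else vnorm x powr \<kappa>)) \<and>
        0 * vnorm (realization \<Phi> x)
          \<le> K * (\<epsilon> powr (- 0) * real d powr K + vnorm x)"
    using \<Phi> G l C[OF d] net_Cont[OF G(1)] K \<kappa>
    by (intro bexI[of _ \<Phi>] exI[of _ l]) auto
qed

lemma C1_cyl_Cont:
  assumes "w \<in> C1_cyl T d" "t \<in> {0..T}"
  shows "(\<lambda>x. emb1 (w t x)) \<in> Cont d 1"
  unfolding Cont_def mem_Collect_eq
proof (rule continuous_map_into_Rtop)
  fix i :: nat assume "i < 1"
  have "continuous_map (Rtop d) (prod_topology (top_of_set {0..T}) (Rtop d)) (\<lambda>x. (t, x))"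
    using assms(2) by (simp add: continuous_map_pairwise o_def)
  moreover have "continuous_map (prod_topology (top_of_set {0..T}) (Rtop d)) euclideanreal (\<lambda>(t, x). w t x)"
    using assms(1) unfolding C1_cyl_def by simp
  ultimately have "continuous_map (Rtop d) euclideanreal ((\<lambda>(t, x). w t x) \<circ> (\<lambda>x. (t, x)))"
    by (rule continuous_map_compose)
  then show "continuous_map (Rtop d) euclideanreal (\<lambda>x. emb1 (w t x) $ i)"
    using \<open>i < 1\<close> by (simp add: o_def emb1_def)
qed (simp add: emb1_def)

lemma vnorm_emb1_diff:
  assumes "y \<in> carrier_vec 1"
  shows "vnorm (emb1 a - y) = \<bar>a - y $ 0\<bar>"
  using assms by (simp add: vnorm_def L2_set_def emb1_def lessThan_Suc)

theorem theorem1p3: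
  fixes T c \<kappa> \<delta> :: real
    and f :: "nat \<Rightarrow> rvec \<Rightarrow> rvec"
    and u :: "nat \<Rightarrow> real \<Rightarrow> rvec \<Rightarrow> real"
  assumes "0 < T" and "0 < c" and "1 \<le> \<kappa>" and "0 < \<delta>" and "\<delta> < 1 / \<kappa>"
    and "f \<in> approx_space \<kappa> \<delta>"
    and "\<forall>d\<ge>1. u d \<in> C1_cyl T d"
    and "(\<lambda>d x. emb1 (u d 0 x)) \<in> approx_space \<kappa> 0"
    and "\<forall>d\<ge>1. f d \<in> C1 d d"
    and "\<forall>d\<ge>1. vnorm (f d (0\<^sub>v d)) \<le> c * real d powr c"
    and "\<forall>d\<ge>1. \<forall>x\<in>carrier_vec d. \<forall>y\<in>carrier_vec d.
           vnorm (f d x - f d y) + \<bar>u d 0 x - u d 0 y\<bar> \<le> c * vnorm (x - y)"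
    and "\<forall>d\<ge>1. \<forall>t\<in>{0..T}. \<forall>x\<in>carrier_vec d.
           partial_t T (u d) t x = scalar_prod (grad_x d (u d t) x) (f d x)"
  shows "\<forall>t\<in>{0..T}. (\<lambda>d x. emb1 (u d t x)) \<in> approx_space \<kappa> 0"
proof
  fix t assume t: "t \<in> {0..T}"
  have \<kappa>0: "\<kappa> \<noteq> 0" using assms(3) by simp
  have fC: "\<forall>d\<ge>1. f d \<in> Cont d d" using assms(9) by (simp add: C1_def)
  have uC: "(\<lambda>x. emb1 (u d s x)) \<in> Cont d 1" if "1 \<le> d" "s \<in> {0..T}" for d s
    using C1_cyl_Cont assms(7) that by blast
  have uC0: "\<forall>d\<ge>1. (\<lambda>x. emb1 (u d 0 x)) \<in> Cont d 1"
    using uC assms(1) by simp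
  obtain Kf where Kf: "\<forall>L\<ge>Kf. \<forall>d\<ge>1. \<forall>\<epsilon>\<in>{0<..1}. \<exists>p \<phi>. net d d p \<phi> \<and>
    real p \<le> L * (real d / \<epsilon>) powr L \<and>
    (\<forall>x\<in>carrier_vec d. vnorm (f d x - \<phi> x) \<le> \<epsilon> * (1 + vnorm x powr \<kappa>) \<and>
       \<delta> * vnorm (\<phi> x) \<le> L * (\<epsilon> powr (- \<delta>) * real d powr L + vnorm x))"
    using approx_space_net[where l = "\<lambda>d. d", OF assms(6) \<kappa>0 fC] by (elim exE)
  obtain Ku where Ku: "\<forall>L\<ge>Ku. \<forall>d\<ge>1. \<forall>\<epsilon>\<in>{0<..1}. \<exists>p \<phi>. net d 1 p \<phi> \<and>
    real p \<le> L * (real d / \<epsilon>) powr L \<and>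
    (\<forall>x\<in>carrier_vec d. vnorm (emb1 (u d 0 x) - \<phi> x) \<le> \<epsilon> * (1 + vnorm x powr \<kappa>) \<and>
       0 * vnorm (\<phi> x) \<le> L * (\<epsilon> powr (- 0) * real d powr L + vnorm x))"
    using approx_space_net[where l = "\<lambda>_. 1", OF assms(8) \<kappa>0 uC0] by (elim exE)
  define K where "K = max 1 (max Kf Ku)"
  have K: "1 \<le> K" "Kf \<le> K" "Ku \<le> K" by (simp_all add: K_def)
  \<comment> \<open>Dividing the growth clause by \<open>\<delta>\<close> gives the growth constant
    \<open>K / \<delta>\<close>, which takes the place of \<open>K\<close> in
    \<open>network_error\<close>. \<open>C1\<close> and \<open>C2\<close> are the constants that
    result there, independent of \<open>d\<close> and \<open>\<epsilon>\<close>.\<close>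
  define A where "A = exp (T * (K / \<delta>)) * (1 + T * (K / \<delta>))"
  define C1 where "C1 = c * exp (T * c) * T * (c * T * exp (T * c) * (4 * c * A))"
  define C2 where "C2 = (c * exp (T * c) * T + 1) * (2 * (2 * A) powr \<kappa>)"
  have TK: "0 \<le> T * (K / \<delta>)" using assms(1,4) K by simp
  have "1 * 1 \<le> A" unfolding A_def using TK by (intro mult_mono) auto
  then have A: "1 \<le> A" by simp
  have C1: "0 \<le> C1" using assms(1,2) A by (simp add: C1_def)
  have "1 * 1 \<le> C2" unfolding C2_def
  proof (rule mult_mono)
    have "1 \<le> (2 * A) powr \<kappa>" using A assms(3) by (intro ge_one_powr_ge_zero) auto
    then show "1 \<le> 2 * (2 * A) powr \<kappa>" by simp
  qed (use assms(1,2) in auto)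
  then have C2: "1 \<le> C2" by simp
  obtain K' where K': "1 \<le> K'" "\<forall>d\<ge>1::nat. \<forall>\<epsilon>\<in>{0<..1}. \<exists>\<eta>\<in>{0<..1}. \<exists>N\<ge>1::nat.
    C1 * real d powr c * (\<eta> powr (- \<delta>) * real d powr K) / real N +
      C2 * (\<eta> * (\<eta> powr (- \<delta>) * real d powr K) powr \<kappa>) \<le> \<epsilon> \<and>
    (\<forall>p r q. real p \<le> K * (real d / \<eta>) powr K \<longrightarrow> real r \<le> K * (real d / \<eta>) powr K \<longrightarrow>
      q \<le> 2 * (d * (d + 1)) + N * (2 * ((2 * d + 1) ^ 3 * p)) + (2 * d + 1) * r \<longrightarrow>
      real q \<le> K' * (real d / \<epsilon>) powr K')"
    using parameter_choice[OF C1 C2 assms(2) K(1) assms(3-5)] by (elim exE conjE)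
  show "(\<lambda>d x. emb1 (u d t x)) \<in> approx_space \<kappa> 0"
  proof (rule approx_spaceI[OF \<kappa>0 order_refl, of K'])
    show "0 \<le> K'" using K'(1) by simp
    show "(\<lambda>x. emb1 (u d t x)) \<in> Cont d 1" if "1 \<le> d" for d using uC[OF that t] .
  next
    fix d :: nat and \<epsilon> :: real assume d: "1 \<le> d" and \<epsilon>: "\<epsilon> \<in> {0<..1}"
    obtain \<eta> N where \<eta>: "\<eta> \<in> {0<..1}" and N: "1 \<le> N"
      and error: "C1 * real d powr c * (\<eta> powr (- \<delta>) * real d powr K) / real N +
        C2 * (\<eta> * (\<eta> powr (- \<delta>) * real d powr K) powr \<kappa>) \<le> \<epsilon>"
      and size: "\<forall>p r q. real p \<le> K * (real d / \<eta>) powr K \<longrightarrow> real r \<le> K * (real d / \<eta>) powr K \<longrightarrow>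
        q \<le> 2 * (d * (d + 1)) + N * (2 * ((2 * d + 1) ^ 3 * p)) + (2 * d + 1) * r \<longrightarrow>
        real q \<le> K' * (real d / \<epsilon>) powr K'"
      using K'(2)[rule_format, OF d \<epsilon>] by (elim bexE exE conjE)
    obtain p \<phi> where \<phi>: "net d d p \<phi>" "real p \<le> K * (real d / \<eta>) powr K"
      "\<forall>x\<in>carrier_vec d. vnorm (f d x - \<phi> x) \<le> \<eta> * (1 + vnorm x powr \<kappa>) \<and>
         \<delta> * vnorm (\<phi> x) \<le> K * (\<eta> powr (- \<delta>) * real d powr K + vnorm x)"
      using Kf[rule_format, OF K(2) d \<eta>] by (elim exE conjE)
    obtain r \<psi> where \<psi>: "net d 1 r \<psi>" "real r \<le> K * (real d / \<eta>) powr K"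
      "\<forall>x\<in>carrier_vec d. vnorm (emb1 (u d 0 x) - \<psi> x) \<le> \<eta> * (1 + vnorm x powr \<kappa>) \<and>
         0 * vnorm (\<psi> x) \<le> K * (\<eta> powr (- 0) * real d powr K + vnorm x)"
      using Ku[rule_format, OF K(3) d \<eta>] by (elim exE conjE)
    obtain G q where G: "net d 1 q G"
      "q \<le> 2 * (d * (d + 1)) + N * (2 * ((2 * d + 1) ^ 3 * p)) + (2 * d + 1) * r"
      "\<forall>x\<in>carrier_vec d. G x = \<psi> (((\<lambda>y. y + (t / real N) \<cdot>\<^sub>v \<phi> y) ^^ N) x)"
      using net_euler[OF \<phi>(1) \<psi>(1), of N "t / real N"] by (elim exE conjE)
    \<comment> \<open>The joint Lipschitz hypothesis yields both bounds with the same
      \<open>c\<close>, as each summand is nonnegative; \<open>c\<close> does not vary with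
      \<open>d\<close>.\<close>
    interpret transport c d "f d" T "u d"
    proof
      show "0 < c" "0 < T" "u d \<in> C1_cyl T d" using assms(1,2,7) d by simp_all
      show "f d \<in> carrier_vec d \<rightarrow> carrier_vec d" using Cont_carrier[OF fC[rule_format, OF d]] by blast
      fix x y :: rvec assume xy: "x \<in> carrier_vec d" "y \<in> carrier_vec d"
      have "vnorm (f d x - f d y) + \<bar>u d 0 x - u d 0 y\<bar> \<le> c * vnorm (x - y)"
        using assms(11) d xy by blast
      then show "vnorm (f d x - f d y) \<le> c * vnorm (x - y)"
        "\<bar>u d 0 x - u d 0 y\<bar> \<le> c * vnorm (x - y)"
        using vnorm_nonneg[of "f d x - f d y"] by linarith+
    next
      fix s :: real and x :: rvec assume "s \<in> {0..T}" "x \<in> carrier_vec d"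
      then show "partial_t T (u d) s x = scalar_prod (grad_x d (u d s) x) (f d x)"
        using assms(12) d by blast
    qed
    define S where "S = \<eta> powr (- \<delta>) * real d powr K"
    have "vnorm (emb1 (u d t x) - G x) \<le> \<epsilon> * (1 + vnorm x powr \<kappa>)" if x: "x \<in> carrier_vec d" for x
    proof -
      have \<phi>C: "\<phi> \<in> carrier_vec d \<rightarrow> carrier_vec d" using net_carrier[OF \<phi>(1)] by blast
      have \<psi>C: "\<psi> y \<in> carrier_vec 1" if "y \<in> carrier_vec d" for y using net_carrier[OF \<psi>(1) that] .
      let ?y = "euler \<phi> (t / real N) N x"
      have y: "?y \<in> carrier_vec d" by (rule euler_carrier[OF \<phi>C x])
      have "\<bar>u d t x - \<psi> ?y $ 0\<bar> \<le> (C1 * real d powr c * S / real N + C2 * (\<eta> * S powr \<kappa>)) * (1 + vnorm x powr \<kappa>)"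
        unfolding C1_def C2_def A_def
      proof (rule network_error[OF x \<phi>C _ _ _ assms(3), where \<psi> = "\<lambda>y. \<psi> y $ 0"])
        show "0 \<le> t" "t \<le> T" "0 < N" "0 \<le> \<eta>" "0 \<le> K / \<delta>" using t N \<eta> K assms(4) by auto
        have "1 powr (- \<delta>) \<le> \<eta> powr (- \<delta>)" using \<eta> assms(4) by (intro powr_mono2') auto
        moreover have "1 \<le> real d powr K" using d K by (intro ge_one_powr_ge_zero) auto
        ultimately have "1 * 1 \<le> S" unfolding S_def by (intro mult_mono) auto
        then show "1 \<le> S" by simp
        show "1 \<le> real d powr c" using d assms(2) by (intro ge_one_powr_ge_zero) auto
        show "vnorm (f d (0\<^sub>v d)) \<le> c * real d powr c" using assms(10) d by blast
        fix y :: rvec assume y: "y \<in> carrier_vec d"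
        show "vnorm (f d y - \<phi> y) \<le> \<eta> * (1 + vnorm y powr \<kappa>)" using \<phi>(3) y by blast
        have "\<delta> * vnorm (\<phi> y) \<le> K * (S + vnorm y)" using \<phi>(3) y by (simp add: S_def)
        then show "vnorm (\<phi> y) \<le> K / \<delta> * (S + vnorm y)" using assms(4) by (simp add: field_simps)
        show "\<bar>u d 0 y - \<psi> y $ 0\<bar> \<le> \<eta> * (1 + vnorm y powr \<kappa>)"
          using bspec[OF \<psi>(3) y] by (simp add: vnorm_emb1_diff[OF \<psi>C[OF y]])
      qed
      also have "\<dots> \<le> \<epsilon> * (1 + vnorm x powr \<kappa>)"
        using error by (intro mult_right_mono) (auto simp: S_def)
      finally show ?thesis
        using G(3) x by (simp add: vnorm_emb1_diff[OF \<psi>C[OF y]] flip: euler_def)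
    qed
    moreover have "real q \<le> K' * (real d / \<epsilon>) powr K'" using size \<phi>(2) \<psi>(2) G(2) by blast
    ultimately show "\<exists>p G. net d 1 p G \<and> real p \<le> K' * (real d / \<epsilon>) powr K' \<and>
      (\<forall>x\<in>carrier_vec d. vnorm (emb1 (u d t x) - G x) \<le> \<epsilon> * (1 + vnorm x powr \<kappa>))"
      using G(1) by (intro exI[of _ q] exI[of _ G]) simp
  qed
qed

end
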